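(* The polynomial $Q_D(s,t)$ is an invariant of a twisted link; that is, if $D$ and $D'$ are equivalent twisted link diagrams, then $Q_D(s,t)=Q_{D'}(s,t)$.
   Context: A virtual link diagram is a collection of immersed oriented loops in $\mathbb{R}^2$ whose multiple points are transverse double points, each of which is either a classical crossing (with over/under information, and with a sign ${\rm sgn}(c)\in\{+1,-1\}$ as usual) or a virtual crossing (without over/under information). A twisted link diagram is a virtual link diagram possibly with finitely many bars (short transverse marks) on its arcs. Generalized Reidemeister moves are the classical Reidemeister moves I, II, III and the virtual Reidemeister moves: the analogues of I, II, III in which all crossings are virtual, and the mixed move IV in which an arc with two virtual crossings is moved across a classical crossing. (No bars occur in the regions where these moves are applied.) Twisted moves are: (I) a bar on a strand slides along that strand through a virtual crossing; (II) two adjacent bars on an arc are created or removed; (III) a classical crossing with one bar on each of its four legs is replaced by a tangle without bars, in which the two strands connect the same pairs of endpoints as before and cross three times, at a virtual crossing, a classical crossing and a virtual crossing in succession, where at the classical crossing the strand which was the over strand becomes the under strand and vice versa (the sign of the classical crossing is unchanged); and conversely. Two twisted link diagrams are equivalent if they are related by a finite sequence of generalized Reidemeister moves, twisted moves and isotopies of $\mathbb{R}^2$. A twisted link is an equivalence class of twisted link diagrams. For a twisted link diagram $D$, ${\rm Self}X(D)$ is the set of classical crossings of $D$ whose over and under paths lie on the same component. For $c\in{\rm Self}X(D)$, smoothing $D$ at $c$ respecting the orientation splits the component through $c$ into two: the over counting component $D_c^{\rm O}$, which leaves $c$ along the outgoing over strand and returns to $c$ along the incoming under strand, and the under counting component $D_c^{\rm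 U}$, which leaves $c$ along the outgoing under strand and returns along the incoming over strand. For $\ast\in\{{\rm O},{\rm U}\}$ let $\gamma_1,\dots,\gamma_k$ be the sequence of classical crossings of $D$ met when travelling once along $D_c^\ast$ from a point near $c$ back to that point ($c$ itself is not included; crossings with other components are included; a self-crossing of $D_c^\ast$ appears twice). The flat sign $\iota(\gamma_i,D_c^\ast)$ is ${\rm sgn}(\gamma_i)$ if $\gamma_i$ is passed as an under crossing and $-{\rm sgn}(\gamma_i)$ if passed as an over crossing. Put ${\rm ind}^\ast(c)=\sum_i\iota(\gamma_i,D_c^\ast)$, ignoring bars. Let $\bar\rho^{\ast}(c)$ be $1$ if ${\rm ind}^\ast(c)$ is odd and $0$ if it is even. Let $p^{\ast}(c)$ be $1$ if the number of bars on $D_c^\ast$ is odd and $0$ if it is even. Define $$Q_D(s,t)=\sum_{c\in{\rm Self}X(D)}{\rm sgn}(c)\,\bigl(s^{\bar\rho^{\rm O}(c)}t^{p^{\rm O}(c)}-1\bigr)\bigl(s^{\bar\rho^{\rm U}(c)}t^{p^{\rm U}(c)}-1\bigr).$$ *)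

theory Defs
  imports "HOL-Analysis.Analysis" "HOL-Computational_Algebra.Polynomial"
begin

section \<open>Twisted link diagrams\<close>

text \<open>
  The components are the loops number \<open>i < comps D\<close>, each of them given by a 1-periodic
  parametrization.  A \<^emph>\<open>passage\<close> \<open>(i, r)\<close> with \<open>0 \<le> r < 1\<close> is a point of the parameter circle of
  the \<open>i\<close>-th loop.  A classical crossing is recorded as the pair of its over passage and its under
  passage; a double point that is not recorded in \<open>classical D\<close> is a virtual crossing.
\<close>

type_synonym passage = "nat \<times> real"

record diagram =
  comps :: nat
  loop :: "nat \<Rightarrow> real \<Rightarrow> real^2"
  classical :: "(passage \<times> passage) set"
  bars :: "passage set"

definition passages :: "diagram \<Rightarrow> passage set" where
  "passages D = {..<comps D} \<times> {0..<1}"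

definition pt :: "diagram \<Rightarrow> passage \<Rightarrow> real^2" where
  "pt D p = loop D (fst p) (snd p)"

definition tangent :: "diagram \<Rightarrow> passage \<Rightarrow> real^2" where
  "tangent D p = vector_derivative (loop D (fst p)) (at (snd p))"

text \<open>Every double point occurs twice, once for each order of its two passages.\<close>

definition double_points :: "diagram \<Rightarrow> (passage \<times> passage) set" where
  "double_points D =
     {(p, q). p \<in> passages D \<and> q \<in> passages D \<and> p \<noteq> q \<and> pt D p = pt D q}"

definition virtual :: "diagram \<Rightarrow> (passage \<times> passage) set" where
  "virtual D = double_points D - (classical D \<union> (classical D)\<inverse>)"

text \<open>The rows of the determinant are the two tangent vectors.\<close>

definition tangent_det :: "diagram \<Rightarrow> passage \<times> passage \<Rightarrow> real" where
  "tangent_det D c = det (vector [tangent D (fst c), tangent D (snd c)] :: real^2^2)"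

text \<open>
  Finiteness of the set of double points already follows from compactness and the other
  conditions.
\<close>

definition twisted_diagram :: "diagram \<Rightarrow> bool" where
  "twisted_diagram D \<longleftrightarrow>
     (\<forall>i<comps D. loop D i C1_differentiable_on UNIV \<and>
        (\<forall>r. loop D i (r + 1) = loop D i r \<and> vector_derivative (loop D i) (at r) \<noteq> 0)) \<and>
     finite (double_points D) \<and>
     (\<forall>c\<in>double_points D. tangent_det D c \<noteq> 0) \<and>
     (\<forall>p q r. (p, q) \<in> double_points D \<and> (p, r) \<in> double_points D \<longrightarrow> q = r) \<and>
     classical D \<subseteq> double_points D \<and> classical D \<inter> (classical D)\<inverse> = {} \<and>
     finite (bars D) \<and> bars D \<subseteq> passages D \<and> bars D \<inter> Domain (double_points D) = {}"

text \<open>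
  For a classical crossing, the pair is (over, under): the crossing is positive iff the
  direction of the over strand followed by that of the under strand is a positive basis of the
  plane.
\<close>

definition crossing_sign :: "diagram \<Rightarrow> passage \<times> passage \<Rightarrow> int" where
  "crossing_sign D c = (if tangent_det D c > 0 then 1 else - 1)"


section \<open>The polynomial\<close>

definition SelfX :: "diagram \<Rightarrow> (passage \<times> passage) set" where
  "SelfX D = {c \<in> classical D. fst (fst c) = fst (snd c)}"

text \<open>The part of a loop that is travelled from one passage to another, without its two ends.\<close>

definition arc_between :: "passage \<Rightarrow> passage \<Rightarrow> passage set" where
  "arc_between p q =
     {(i, r). i = fst p \<and> 0 \<le> r \<and> r < 1 \<and>
        (if snd p < snd q then snd p < r \<and> r < snd q else snd p < r \<or> r < snd q)}"

definition over_component :: "passage \<times> passage \<Rightarrow> passage set" where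
  "over_component c = arc_between (fst c) (snd c)"

definition under_component :: "passage \<times> passage \<Rightarrow> passage set" where
  "under_component c = arc_between (snd c) (fst c)"

text \<open>
  The sum of the flat signs along a set \<open>A\<close> of passages.  A crossing both of whose passages are
  in \<open>A\<close> is counted in both sums.
\<close>

definition flat_index :: "diagram \<Rightarrow> passage set \<Rightarrow> int" where
  "flat_index D A =
     (\<Sum>c | c \<in> classical D \<and> snd c \<in> A. crossing_sign D c) +
     (\<Sum>c | c \<in> classical D \<and> fst c \<in> A. - crossing_sign D c)"

definition index_parity :: "diagram \<Rightarrow> passage set \<Rightarrow> nat" where
  "index_parity D A = (if odd (flat_index D A) then 1 else 0)"

definition bar_parity :: "diagram \<Rightarrow> passage set \<Rightarrow> nat" where
  "bar_parity D A = (if odd (card (bars D \<inter> A)) then 1 else 0)"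

text \<open>Polynomials in \<open>s\<close> and \<open>t\<close> over the integers are polynomials in \<open>t\<close> over \<open>\<int>[s]\<close>.\<close>

definition var_s :: "int poly poly" where
  "var_s = [:[:0, 1:]:]"

definition var_t :: "int poly poly" where
  "var_t = [:0, 1:]"

definition component_weight :: "diagram \<Rightarrow> passage set \<Rightarrow> int poly poly" where
  "component_weight D A = var_s ^ index_parity D A * var_t ^ bar_parity D A - 1"

definition Q_poly :: "diagram \<Rightarrow> int poly poly" where
  "Q_poly D = (\<Sum>c\<in>SelfX D. of_int (crossing_sign D c) *
     component_weight D (over_component c) * component_weight D (under_component c))"


section \<open>Isotopies of the plane\<close>

definition plane_isotopy :: "(real \<Rightarrow> real^2 \<Rightarrow> real^2) \<Rightarrow> bool" where
  "plane_isotopy H \<longleftrightarrow>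
     H 0 = id \<and> (\<forall>u\<in>{0..1}. bij (H u)) \<and>
     continuous_on ({0..1} \<times> UNIV) (\<lambda>(u, x). H u x) \<and>
     (\<exists>J :: real \<Rightarrow> real^2 \<Rightarrow> real^2^2.
        continuous_on ({0..1} \<times> UNIV) (\<lambda>(u, x). J u x) \<and>
        (\<forall>u\<in>{0..1}. \<forall>x. (H u has_derivative (\<lambda>v. J u x *v v)) (at x) \<and> invertible (J u x)))"

definition circle_reparam :: "(real \<Rightarrow> real) \<Rightarrow> bool" where
  "circle_reparam \<phi> \<longleftrightarrow>
     \<phi> C1_differentiable_on UNIV \<and> (\<forall>r. \<phi> (r + 1) = \<phi> r + 1 \<and> vector_derivative \<phi> (at r) > 0)"

text \<open>
  Loops carry neither a number nor a parametrization; so two diagrams that only differ by a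
  renumbering and by orientation preserving reparametrizations of the loops have to be identified.
\<close>

definition isotopic :: "diagram \<Rightarrow> diagram \<Rightarrow> bool" where
  "isotopic D D' \<longleftrightarrow> twisted_diagram D \<and> twisted_diagram D' \<and>
     (\<exists>H \<pi> \<phi>. plane_isotopy H \<and> bij_betw \<pi> {..<comps D} {..<comps D'} \<and>
        (\<forall>i<comps D. circle_reparam (\<phi> i) \<and>
           (\<forall>r. loop D' (\<pi> i) (\<phi> i r) = H 1 (loop D i r))) \<and>
        (let \<tau> = (\<lambda>(i, r). (\<pi> i, frac (\<phi> i r))) in
           classical D' = map_prod \<tau> \<tau> ` classical D \<and> bars D' = \<tau> ` bars D))"


section \<open>Local moves\<close>

text \<open>
  A move takes place in a closed disc \<open>\<Delta>\<close>, which the diagram meets in finitely many strands.  The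
  strand \<open>(i, a, b)\<close> consists of the points of the \<open>i\<close>-th loop with parameters in \<open>[a, b]\<close>; only
  its two ends lie on the boundary of the disc.  That no strand contains the parameter 0 is no
  restriction, as the loops can be reparametrized.  A move does not affect the parameters at which
  the strands enter and leave the disc, and so the strands connect the same pairs of boundary
  points before and after it.
\<close>

type_synonym strand = "nat \<times> real \<times> real"

definition closed_strand :: "strand \<Rightarrow> passage set" where
  "closed_strand S = (case S of (i, a, b) \<Rightarrow> {i} \<times> {a..b})"

definition on :: "strand \<Rightarrow> passage set" where
  "on S = (case S of (i, a, b) \<Rightarrow> {i} \<times> {a<..<b})"

definition meets_in_strands :: "diagram \<Rightarrow> (real^2) set \<Rightarrow> strand list \<Rightarrow> bool" where
  "meets_in_strands D \<Delta> Ss \<longleftrightarrow>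
     (\<forall>(i, a, b)\<in>set Ss. i < comps D \<and> 0 < a \<and> a < b \<and> b < 1) \<and>
     distinct Ss \<and> pairwise (\<lambda>S T. disjnt (closed_strand S) (closed_strand T)) (set Ss) \<and>
     {p \<in> passages D. pt D p \<in> \<Delta>} = (\<Union>S\<in>set Ss. closed_strand S) \<and>
     {p \<in> passages D. pt D p \<in> interior \<Delta>} = (\<Union>S\<in>set Ss. on S)"

definition local_change ::
    "diagram \<Rightarrow> diagram \<Rightarrow> (real^2) set \<Rightarrow> strand list \<Rightarrow> bool" where
  "local_change D D' \<Delta> Ss \<longleftrightarrow>
     twisted_diagram D \<and> twisted_diagram D' \<and> comps D' = comps D \<and>
     \<Delta> homeomorphic cball (0 :: real^2) 1 \<and>
     meets_in_strands D \<Delta> Ss \<and> meets_in_strands D' \<Delta> Ss \<and>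
     (\<forall>p \<in> passages D - (\<Union>S\<in>set Ss. on S). pt D' p = pt D p) \<and>
     {c \<in> classical D'. pt D' (fst c) \<notin> \<Delta>} = {c \<in> classical D. pt D (fst c) \<notin> \<Delta>} \<and>
     {p \<in> bars D'. pt D' p \<notin> \<Delta>} = {p \<in> bars D. pt D p \<notin> \<Delta>}"

text \<open>
  The tangle in \<open>\<Delta>\<close> has exactly the classical crossings \<open>cl\<close>, the virtual crossings \<open>vi\<close> (each
  listed in one of its two orders) and the bars \<open>bs\<close>.
\<close>

definition tangle :: "diagram \<Rightarrow> (real^2) set \<Rightarrow>
    (passage \<times> passage) set \<Rightarrow> (passage \<times> passage) set \<Rightarrow> passage set \<Rightarrow> bool" where
  "tangle D \<Delta> cl vi bs \<longleftrightarrow>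
     {c \<in> classical D. pt D (fst c) \<in> \<Delta>} = cl \<and>
     {c \<in> virtual D. pt D (fst c) \<in> \<Delta>} = vi \<union> vi\<inverse> \<and>
     {p \<in> bars D. pt D p \<in> \<Delta>} = bs"

text \<open>
  The tangles of the pictures of the moves are determined, up to isotopy of the disc, by the
  crossings of their strands together with the order of these crossings along the strands.  The
  equations between crossing signs below restrict nothing: both tangles of a move have the same
  strand ends on the boundary of the disc, and this forces these equations.
\<close>

definition reidemeister_1 :: "diagram \<Rightarrow> diagram \<Rightarrow> bool" where
  "reidemeister_1 D D' \<longleftrightarrow>
     (\<exists>\<Delta> A. local_change D D' \<Delta> [A] \<and> tangle D \<Delta> {} {} {} \<and>
        (\<exists>x \<in> on A \<times> on A. tangle D' \<Delta> {x} {} {}))"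

definition virtual_1 :: "diagram \<Rightarrow> diagram \<Rightarrow> bool" where
  "virtual_1 D D' \<longleftrightarrow>
     (\<exists>\<Delta> A. local_change D D' \<Delta> [A] \<and> tangle D \<Delta> {} {} {} \<and>
        (\<exists>x \<in> on A \<times> on A. tangle D' \<Delta> {} {x} {}))"

definition reidemeister_2 :: "diagram \<Rightarrow> diagram \<Rightarrow> bool" where
  "reidemeister_2 D D' \<longleftrightarrow>
     (\<exists>\<Delta> A B. local_change D D' \<Delta> [A, B] \<and> tangle D \<Delta> {} {} {} \<and>
        (\<exists>x \<in> on A \<times> on B. \<exists>y \<in> on A \<times> on B. x \<noteq> y \<and>
           tangle D' \<Delta> {x, y} {} {} \<and> crossing_sign D' x = - crossing_sign D' y))"

definition virtual_2 :: "diagram \<Rightarrow> diagram \<Rightarrow> bool" where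
  "virtual_2 D D' \<longleftrightarrow>
     (\<exists>\<Delta> A B. local_change D D' \<Delta> [A, B] \<and> tangle D \<Delta> {} {} {} \<and>
        (\<exists>x \<in> on A \<times> on B. \<exists>y \<in> on A \<times> on B. x \<noteq> y \<and> tangle D' \<Delta> {} {x, y} {}))"

definition opposite_order :: "passage \<Rightarrow> passage \<Rightarrow> passage \<Rightarrow> passage \<Rightarrow> bool" where
  "opposite_order p q p' q' \<longleftrightarrow> (snd p < snd q \<longleftrightarrow> snd q' < snd p')"

text \<open>
  Three strands \<open>A\<close>, \<open>B\<close>, \<open>C\<close> cross pairwise once: \<open>A\<close> and \<open>B\<close> at \<open>x\<close>, \<open>A\<close> and \<open>C\<close> at \<open>y\<close>, \<open>B\<close> and
  \<open>C\<close> at \<open>z\<close>.  Moving a strand across the crossing of the other two reverses, on each strand, the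
  order in which it meets the other two.
\<close>

definition triangle_change :: "diagram \<Rightarrow> diagram \<Rightarrow> (real^2) set \<Rightarrow>
    passage \<times> passage \<Rightarrow> passage \<times> passage \<Rightarrow> passage \<times> passage \<Rightarrow>
    passage \<times> passage \<Rightarrow> passage \<times> passage \<Rightarrow> passage \<times> passage \<Rightarrow> bool" where
  "triangle_change D D' \<Delta> x y z x' y' z' \<longleftrightarrow>
     (\<exists>A B C. local_change D D' \<Delta> [A, B, C] \<and>
        {x, x'} \<subseteq> on A \<times> on B \<and> {y, y'} \<subseteq> on A \<times> on C \<and> {z, z'} \<subseteq> on B \<times> on C \<and>
        opposite_order (fst x) (fst y) (fst x') (fst y') \<and>
        opposite_order (snd x) (fst z) (snd x') (fst z') \<and>
        opposite_order (snd y) (snd z) (snd y') (snd z') \<and>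
        crossing_sign D' x' = crossing_sign D x \<and>
        crossing_sign D' y' = crossing_sign D y \<and>
        crossing_sign D' z' = crossing_sign D z)"

definition reidemeister_3 :: "diagram \<Rightarrow> diagram \<Rightarrow> bool" where
  "reidemeister_3 D D' \<longleftrightarrow>
     (\<exists>\<Delta> x y z x' y' z'. triangle_change D D' \<Delta> x y z x' y' z' \<and>
        tangle D \<Delta> {x, y, z} {} {} \<and> tangle D' \<Delta> {x', y', z'} {} {})"

definition virtual_3 :: "diagram \<Rightarrow> diagram \<Rightarrow> bool" where
  "virtual_3 D D' \<longleftrightarrow>
     (\<exists>\<Delta> x y z x' y' z'. triangle_change D D' \<Delta> x y z x' y' z' \<and>
        tangle D \<Delta> {} {x, y, z} {} \<and> tangle D' \<Delta> {} {x', y', z'} {})"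

definition virtual_4 :: "diagram \<Rightarrow> diagram \<Rightarrow> bool" where
  "virtual_4 D D' \<longleftrightarrow>
     (\<exists>\<Delta> x y z x' y' z'. triangle_change D D' \<Delta> x y z x' y' z' \<and>
        tangle D \<Delta> {z} {x, y} {} \<and> tangle D' \<Delta> {z'} {x', y'} {})"

definition twisted_1 :: "diagram \<Rightarrow> diagram \<Rightarrow> bool" where
  "twisted_1 D D' \<longleftrightarrow>
     (\<exists>\<Delta> A B. local_change D D' \<Delta> [A, B] \<and>
        (\<exists>x \<in> on A \<times> on B. \<exists>x' \<in> on A \<times> on B. \<exists>b \<in> on A. \<exists>b' \<in> on A.
           tangle D \<Delta> {} {x} {b} \<and> snd b < snd (fst x) \<and>
           tangle D' \<Delta> {} {x'} {b'} \<and> snd (fst x') < snd b'))"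

definition twisted_2 :: "diagram \<Rightarrow> diagram \<Rightarrow> bool" where
  "twisted_2 D D' \<longleftrightarrow>
     (\<exists>\<Delta> A. local_change D D' \<Delta> [A] \<and> tangle D \<Delta> {} {} {} \<and>
        (\<exists>b \<in> on A. \<exists>b' \<in> on A. b \<noteq> b' \<and> tangle D' \<Delta> {} {} {b, b'}))"

definition strictly_between :: "passage \<Rightarrow> passage \<Rightarrow> passage \<Rightarrow> bool" where
  "strictly_between p q r \<longleftrightarrow> snd p < snd q \<and> snd q < snd r \<or> snd r < snd q \<and> snd q < snd p"

text \<open>
  In \<open>D\<close> the strand \<open>A\<close> passes over \<open>B\<close>, in \<open>D'\<close> it passes under \<open>B\<close>.
\<close>

definition twisted_3 :: "diagram \<Rightarrow> diagram \<Rightarrow> bool" where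
  "twisted_3 D D' \<longleftrightarrow>
     (\<exists>\<Delta> A B. local_change D D' \<Delta> [A, B] \<and>
        (\<exists>x \<in> on A \<times> on B. \<exists>a1 \<in> on A. \<exists>a2 \<in> on A. \<exists>b1 \<in> on B. \<exists>b2 \<in> on B.
         \<exists>x' \<in> on B \<times> on A. \<exists>v \<in> on A \<times> on B. \<exists>w \<in> on A \<times> on B.
           tangle D \<Delta> {x} {} {a1, a2, b1, b2} \<and>
           strictly_between a1 (fst x) a2 \<and> strictly_between b1 (snd x) b2 \<and>
           tangle D' \<Delta> {x'} {v, w} {} \<and>
           strictly_between (fst v) (snd x') (fst w) \<and>
           strictly_between (snd v) (fst x') (snd w) \<and>
           crossing_sign D' x' = crossing_sign D x))"

definition twisted_link_step :: "diagram \<Rightarrow> diagram \<Rightarrow> bool" where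
  "twisted_link_step D D' \<longleftrightarrow> isotopic D D' \<or>
     reidemeister_1 D D' \<or> reidemeister_2 D D' \<or> reidemeister_3 D D' \<or>
     virtual_1 D D' \<or> virtual_2 D D' \<or> virtual_3 D D' \<or> virtual_4 D D' \<or>
     twisted_1 D D' \<or> twisted_2 D D' \<or> twisted_3 D D'"

text \<open>
  The steps relate twisted link diagrams only, so all diagrams in a sequence of
  steps and inverse steps are twisted link diagrams.
\<close>

definition equivalent_diagrams :: "diagram \<Rightarrow> diagram \<Rightarrow> bool" where
  "equivalent_diagrams = equivclp twisted_link_step"

end

theory Submission
  imports Defs
begin

text \<open>
  The index of an arc enters \<open>Q\<close> only modulo 2, and every classical crossing met along the arc
  contributes an odd number to it.  So the index is odd iff the arc contains an odd number of
  passages through classical crossings (\<open>odd_flat_index_iff\<close>): apart from the signs of the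
  self-crossings themselves, \<open>Q\<close> depends only on two counts modulo 2 on each of the two arcs at a
  self-crossing, the number of classical passages and the number of bars.  Both are counts of
  marked points on the loops, and they are treated alike.

  Consider a local move in a disc.  A crossing outside the disc keeps its sign.  Its two arcs end
  outside the disc, so they contain each strand of the disc either completely or not at all; as
  the tangles in the pictures of a move have, on each strand, the same number of classical passages
  and of bars modulo 2, the contribution of the crossing to \<open>Q\<close> does not change
  (\<open>even_card_arc_outside\<close>).  Hence only the crossings in the disc have to be compared
  (\<open>Q_poly_eqI\<close>).  At a crossing of two strands \<open>A\<close> and \<open>B\<close> in the disc, the arc that leaves along
  \<open>A\<close> and returns along \<open>B\<close> consists of the part of \<open>A\<close> after the crossing, the part of \<open>B\<close>
  before it, and a rest on which the counts modulo 2 do not depend on the tangle, so that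
  everything is read off from the picture (\<open>component_weight_between_strands\<close>):

  \<^item> Reidemeister I: the arc inside the disc carries no marks, so one of the two factors is \<open>1 - 1 = 0\<close>.
  \<^item> Reidemeister II: the two crossings have opposite signs, and equal factors, because passing from
    one of them to the other changes the number of classical passages by an even number.
  \<^item> Reidemeister III: at each crossing, the third strand moves from one side to the other
    on both strands.  The two changes cancel modulo 2.
  \<^item> Move IV and twisted moves I and II do not change any of the counts modulo 2.
  \<^item> Twisted move III: each of the two arcs loses one bar on \<open>A\<close> and one bar on \<open>B\<close>.  Over and
    under arc are interchanged, but \<open>Q\<close> is symmetric in the two factors.

  An isotopy preserves the orientation of the plane, because the determinant of its derivative
  starts at 1 and has no zero, and it preserves the direction of the loops.  So it preserves the
  crossing signs and the arcs.
\<close>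

section \<open>Counting passages modulo two\<close>

definition crossing_passages :: "diagram \<Rightarrow> passage set" where
  "crossing_passages D = Field (classical D)"

lemma twisted_diagramD:
  assumes "twisted_diagram D"
  shows "finite (classical D)" "finite (bars D)" "bars D \<subseteq> passages D"
    "classical D \<subseteq> double_points D"
    "\<And>p q r. (p, q) \<in> double_points D \<Longrightarrow> (p, r) \<in> double_points D \<Longrightarrow> q = r"
    "classical D \<inter> (classical D)\<inverse> = {}"
proof -
  show "finite (classical D)"
    by (rule finite_subset[of _ "double_points D"]) (use assms in \<open>simp_all add: twisted_diagram_def\<close>)
  show "(p, q) \<in> double_points D \<Longrightarrow> (p, r) \<in> double_points D \<Longrightarrow> q = r" for p q r
    using assms unfolding twisted_diagram_def by blast
qed (use assms in \<open>simp_all add: twisted_diagram_def\<close>)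

lemma finite_crossing_passages: "twisted_diagram D \<Longrightarrow> finite (crossing_passages D)"
  by (simp add: crossing_passages_def finite_Field twisted_diagramD(1))

lemma double_points_sym: "(p, q) \<in> double_points D \<Longrightarrow> (q, p) \<in> double_points D"
  unfolding double_points_def by auto

lemma classicalD:
  assumes "twisted_diagram D" "c \<in> classical D"
  shows "fst c \<in> passages D" "snd c \<in> passages D" "fst c \<noteq> snd c" "pt D (fst c) = pt D (snd c)"
  using twisted_diagramD(4)[OF assms(1)] assms(2) unfolding double_points_def by auto

lemma crossing_passages_subset: "twisted_diagram D \<Longrightarrow> crossing_passages D \<subseteq> passages D"
  unfolding crossing_passages_def Field_def using classicalD by fastforce

lemma classical_partner_unique:
  assumes D: "twisted_diagram D"
    and "(p, q) \<in> classical D \<union> (classical D)\<inverse>" "(p, r) \<in> classical D \<union> (classical D)\<inverse>"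
  shows "q = r"
proof -
  have "(p, s) \<in> double_points D" if "(p, s) \<in> classical D \<union> (classical D)\<inverse>" for s
    using that twisted_diagramD(4)[OF D] double_points_sym[of s p D] by auto
  then show ?thesis using twisted_diagramD(5)[OF D, of p q r] assms(2,3) by simp
qed

lemma distinct_crossings_distinct_passages:
  assumes D: "twisted_diagram D" and "c \<in> classical D" "e \<in> classical D" "c \<noteq> e"
  shows "fst c \<noteq> fst e" "snd c \<noteq> snd e" "snd c \<noteq> fst e"
proof -
  have c: "(fst c, snd c) \<in> classical D" and e: "(fst e, snd e) \<in> classical D" using assms by simp_all
  show "fst c \<noteq> fst e"
    using classical_partner_unique[OF D, of "fst c" "snd c" "snd e"] c e \<open>c \<noteq> e\<close> by (auto intro: prod_eqI)
  show "snd c \<noteq> snd e"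
    using classical_partner_unique[OF D, of "snd c" "fst c" "fst e"] c e \<open>c \<noteq> e\<close> by (auto intro: prod_eqI)
  show "snd c \<noteq> fst e"
  proof
    assume eq: "snd c = fst e"
    then have "fst c = snd e"
      using classical_partner_unique[OF D, of "snd c" "fst c" "snd e"] c e by auto
    then have "e \<in> (classical D)\<inverse>" using eq c by (metis converseI prod.collapse)
    then show False using twisted_diagramD(6)[OF D] assms(3) by blast
  qed
qed

lemma odd_sum_of_odds:
  fixes f :: "'a \<Rightarrow> int"
  assumes "finite A" "\<And>a. a \<in> A \<Longrightarrow> odd (f a)"
  shows "odd (sum f A) \<longleftrightarrow> odd (card A)"
  using assms by (induction A rule: finite_induct) auto

text \<open>
  Signs are odd, so only the number of summands matters.  A classical passage belongs to a single
  crossing, and is either its over or its under passage; hence the two sums together have one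
  summand for each classical passage in \<open>A\<close>.
\<close>

lemma odd_flat_index_iff:
  assumes D: "twisted_diagram D"
  shows "odd (flat_index D A) \<longleftrightarrow> odd (card (crossing_passages D \<inter> A))"
proof -
  note d = twisted_diagramD[OF D]
  let ?O = "{c \<in> classical D. fst c \<in> A}" and ?U = "{c \<in> classical D. snd c \<in> A}"
  have fin: "finite ?O" "finite ?U" using d(1) by auto
  note distinct = distinct_crossings_distinct_passages[OF D]
  have "inj_on fst ?O" by (rule inj_onI) (use distinct(1) in blast)
  then have O: "card (fst ` ?O) = card ?O" by (rule card_image)
  have "inj_on snd ?U" by (rule inj_onI) (use distinct(2) in blast)
  then have U: "card (snd ` ?U) = card ?U" by (rule card_image)
  have "snd c \<noteq> fst e" if "c \<in> classical D" "e \<in> classical D" for c e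
    using distinct(3)[of c e] classicalD(3)[OF D, of c] that by metis
  then have disj: "fst ` ?O \<inter> snd ` ?U = {}" by fastforce
  have split: "crossing_passages D \<inter> A = fst ` ?O \<union> snd ` ?U"
    unfolding crossing_passages_def Field_def by (auto simp: image_iff)
  have "card (crossing_passages D \<inter> A) = card ?O + card ?U"
    unfolding split using card_Un_disjoint[OF _ _ disj] fin O U by simp
  moreover have "odd (\<Sum>c\<in>?U. crossing_sign D c) \<longleftrightarrow> odd (card ?U)"
    "odd (\<Sum>c\<in>?O. - crossing_sign D c) \<longleftrightarrow> odd (card ?O)"
    by (rule odd_sum_of_odds; use fin in \<open>simp add: crossing_sign_def\<close>)+
  ultimately show ?thesis unfolding flat_index_def by (simp) blast
qed

lemma component_weight_cong:
  assumes "twisted_diagram D" "twisted_diagram D'"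
    and "even (card (crossing_passages D \<inter> X)) \<longleftrightarrow> even (card (crossing_passages D' \<inter> X'))"
    and "even (card (bars D \<inter> X)) \<longleftrightarrow> even (card (bars D' \<inter> X'))"
  shows "component_weight D X = component_weight D' X'"
  using assms by (simp add: component_weight_def index_parity_def bar_parity_def odd_flat_index_iff)

text \<open>
  Crossings of different loops get the value 0, so that \<open>Q\<close> becomes a sum over all classical
  crossings, which splits along the boundary of the disc of a move.
\<close>

definition contribution :: "diagram \<Rightarrow> passage \<times> passage \<Rightarrow> int poly poly" where
  "contribution D c = (if fst (fst c) = fst (snd c)
     then of_int (crossing_sign D c) *
       component_weight D (over_component c) * component_weight D (under_component c)
     else 0)"

lemma Q_poly_eq_sum_contribution:
  assumes "twisted_diagram D"
  shows "Q_poly D = (\<Sum>c\<in>classical D. contribution D c)"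
  unfolding Q_poly_def SelfX_def contribution_def
  using twisted_diagramD(1)[OF assms] by (simp add: sum.inter_filter)

section \<open>Arcs and strands\<close>

lemma mem_closed_strand: "p \<in> closed_strand (i, a, b) \<longleftrightarrow> fst p = i \<and> a \<le> snd p \<and> snd p \<le> b"
  unfolding closed_strand_def by (cases p) auto

lemma mem_on: "p \<in> on (i, a, b) \<longleftrightarrow> fst p = i \<and> a < snd p \<and> snd p < b"
  unfolding on_def by (cases p) auto

lemma on_subset_closed_strand: "p \<in> on S \<Longrightarrow> p \<in> closed_strand S"
  by (cases S) (auto simp: mem_closed_strand mem_on)

lemma mem_arc_between: "r \<in> arc_between p q \<longleftrightarrow> fst r = fst p \<and> 0 \<le> snd r \<and> snd r < 1 \<and>
        (if snd p < snd q then snd p < snd r \<and> snd r < snd q else snd p < snd r \<or> snd r < snd q)"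
  unfolding arc_between_def by (cases r) auto

definition strand_family :: "strand set \<Rightarrow> bool" where
  "strand_family F \<longleftrightarrow> finite F \<and> (\<forall>(i, a, b)\<in>F. 0 < a \<and> a < b \<and> b < 1) \<and>
     pairwise (\<lambda>S T. disjnt (closed_strand S) (closed_strand T)) F"

abbreviation covered :: "strand set \<Rightarrow> passage set" where
  "covered F \<equiv> \<Union>S\<in>F. closed_strand S"

lemma strand_family_disjoint:
  "strand_family F \<Longrightarrow> A \<in> F \<Longrightarrow> B \<in> F \<Longrightarrow> p \<in> closed_strand A \<Longrightarrow> p \<in> closed_strand B \<Longrightarrow> A = B"
  unfolding strand_family_def pairwise_def disjnt_def by blast

text \<open>
  A strand does not contain the parameter 0, so an arc is cut out of it by comparing parameters with
  those of the two ends of the arc.  As these ends are not on the strand, they do not separate any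
  two of its points.
\<close>

lemma strand_in_arc_cases:
  assumes F: "strand_family F" and S: "S \<in> F" and "fst p = fst q"
    and "p \<notin> closed_strand S" "q \<notin> closed_strand S"
  shows "closed_strand S \<subseteq> arc_between p q \<or> closed_strand S \<inter> arc_between p q = {}"
proof -
  obtain i a b where [simp]: "S = (i, a, b)" by (cases S)
  have "0 < a" "a < b" "b < 1" using F S unfolding strand_family_def by auto
  show ?thesis
  proof (cases "fst p = i")
    case True
    with assms have "snd p < a \<or> b < snd p" "snd q < a \<or> b < snd q"
      by (auto simp: mem_closed_strand)
    with True \<open>0 < a\<close> \<open>a < b\<close> \<open>b < 1\<close> show ?thesis
      by (auto simp: subset_eq disjoint_iff mem_closed_strand mem_arc_between)
  qed (auto simp: disjoint_iff mem_closed_strand mem_arc_between)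
qed

lemma strands_ordered:
  assumes F: "strand_family F" and A: "(i, a, b) \<in> F" and B: "(i, c, d) \<in> F"
    and "(i, a, b) \<noteq> (i, c, d)"
  shows "b < c \<or> d < a"
proof (rule ccontr)
  assume "\<not> (b < c \<or> d < a)"
  moreover have "a < b" "c < d" using F A B unfolding strand_family_def by auto
  ultimately have "(i, max a c) \<in> closed_strand (i, a, b)" "(i, max a c) \<in> closed_strand (i, c, d)"
    by (auto simp: mem_closed_strand)
  then show False using strand_family_disjoint[OF F A B] assms by blast
qed

text \<open>
  The strands are disjoint, hence one of them comes entirely before the other in the interval of
  parameters.  Depending on which one it is, the arc from \<open>A\<close> to \<open>B\<close> contains or does not contain
  the parameter 0, but in both cases it uses the last part of \<open>A\<close> and the first part of \<open>B\<close>.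
\<close>

lemma arc_between_strands:
  assumes F: "strand_family F" and A: "A \<in> F" and B: "B \<in> F" and "A \<noteq> B" "fst A = fst B"
    and p: "p \<in> on A" and q: "q \<in> on B"
  shows "m \<in> closed_strand A \<Longrightarrow> m \<in> arc_between p q \<longleftrightarrow> snd p < snd m"
    and "m \<in> closed_strand B \<Longrightarrow> m \<in> arc_between p q \<longleftrightarrow> snd m < snd q"
    and "p' \<in> on A \<Longrightarrow> q' \<in> on B \<Longrightarrow> m \<notin> closed_strand A \<Longrightarrow> m \<notin> closed_strand B \<Longrightarrow>
      m \<in> arc_between p q \<longleftrightarrow> m \<in> arc_between p' q'"
proof -
  obtain i a b c d where [simp]: "A = (i, a, b)" "B = (i, c, d)"
    using \<open>fst A = fst B\<close> by (cases A, cases B) auto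
  have "0 < a" "a < b" "b < 1" "0 < c" "c < d" "d < 1"
    using F A B unfolding strand_family_def by auto
  moreover have "b < c \<or> d < a" using strands_ordered F A B \<open>A \<noteq> B\<close> by simp
  ultimately show "m \<in> closed_strand A \<Longrightarrow> m \<in> arc_between p q \<longleftrightarrow> snd p < snd m"
    and "m \<in> closed_strand B \<Longrightarrow> m \<in> arc_between p q \<longleftrightarrow> snd m < snd q"
    and "p' \<in> on A \<Longrightarrow> q' \<in> on B \<Longrightarrow> m \<notin> closed_strand A \<Longrightarrow> m \<notin> closed_strand B \<Longrightarrow>
      m \<in> arc_between p q \<longleftrightarrow> m \<in> arc_between p' q'"
    using p q unfolding \<open>A = _\<close> \<open>B = _\<close> mem_closed_strand mem_on mem_arc_between by smt+
qed

lemma card_split_by_strands: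
  assumes F: "strand_family F" and "finite M"
  shows "card M = card (M - covered F) + (\<Sum>S\<in>F. card (M \<inter> closed_strand S))"
proof -
  have fin: "finite F" using F unfolding strand_family_def by simp
  have "card (M \<inter> covered F) = card (\<Union>S\<in>F. M \<inter> closed_strand S)" by (rule arg_cong[of _ _ card]) blast
  also have "\<dots> = (\<Sum>S\<in>F. card (M \<inter> closed_strand S))"
    by (rule card_UN_disjoint) (use fin \<open>finite M\<close> strand_family_disjoint[OF F] in auto)
  finally show ?thesis
    using card_Int_Diff[OF \<open>finite M\<close>, of "covered F"] by simp
qed

lemma even_sum_cong:
  fixes f g :: "'a \<Rightarrow> nat"
  assumes "\<And>a. a \<in> A \<Longrightarrow> even (f a) \<longleftrightarrow> even (g a)"
  shows "even (sum f A) \<longleftrightarrow> even (sum g A)"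
proof (cases "finite A")
  case True
  then show ?thesis using assms by (induction A rule: finite_induct) auto
qed simp

lemma even_card_arc_outside:
  assumes F: "strand_family F" and fin: "finite M" "finite M'"
    and out: "M - covered F = M' - covered F"
    and par: "\<And>S. S \<in> F \<Longrightarrow> even (card (M \<inter> closed_strand S)) \<longleftrightarrow> even (card (M' \<inter> closed_strand S))"
    and pq: "fst p = fst q" "p \<notin> covered F" "q \<notin> covered F"
  shows "even (card (M \<inter> arc_between p q)) \<longleftrightarrow> even (card (M' \<inter> arc_between p q))"
proof -
  let ?X = "arc_between p q"
  have "even (card (M \<inter> ?X \<inter> closed_strand S)) \<longleftrightarrow> even (card (M' \<inter> ?X \<inter> closed_strand S))"
    if S: "S \<in> F" for S
  proof -
    have "closed_strand S \<subseteq> ?X \<or> closed_strand S \<inter> ?X = {}"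
      by (rule strand_in_arc_cases[OF F S]) (use pq S in auto)
    then have "(\<forall>N. N \<inter> ?X \<inter> closed_strand S = N \<inter> closed_strand S) \<or>
        (\<forall>N. N \<inter> ?X \<inter> closed_strand S = {})" by blast
    then show ?thesis using par[OF S] by (elim disjE) simp_all
  qed
  then have "even (\<Sum>S\<in>F. card (M \<inter> ?X \<inter> closed_strand S)) \<longleftrightarrow>
      even (\<Sum>S\<in>F. card (M' \<inter> ?X \<inter> closed_strand S))" by (rule even_sum_cong)
  moreover have "M \<inter> ?X - covered F = M' \<inter> ?X - covered F" using out by blast
  ultimately show ?thesis
    using card_split_by_strands[OF F, of "M \<inter> ?X"] card_split_by_strands[OF F, of "M' \<inter> ?X"] fin by simp
qed

text \<open>
  The set \<open>M\<close> stands for the classical passages or for the bars of a diagram, and \<open>M'\<close> for those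
  after the move.  On the two strands where the arc starts and ends only the marks ahead of the
  start and behind the end count; the other strands are again contained in the arc completely or
  not at all.
\<close>

lemma even_card_arc_between_strands:
  assumes F: "strand_family F" and fin: "finite M" "finite M'"
    and out: "M - covered F = M' - covered F"
    and par: "\<And>S. S \<in> F \<Longrightarrow> even (card (M \<inter> closed_strand S)) \<longleftrightarrow> even (card (M' \<inter> closed_strand S))"
    and AB: "A \<in> F" "B \<in> F" "A \<noteq> B" "fst A = fst B"
    and p: "p \<in> on A" "p' \<in> on A" and q: "q \<in> on B" "q' \<in> on B"
    and ends: "even (card {m \<in> M \<inter> closed_strand A. snd p < snd m} +
          card {m \<in> M \<inter> closed_strand B. snd m < snd q}) \<longleftrightarrow>
        even (card {m \<in> M' \<inter> closed_strand A. snd p' < snd m} +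
          card {m \<in> M' \<inter> closed_strand B. snd m < snd q'})"
  shows "even (card (M \<inter> arc_between p q)) \<longleftrightarrow> even (card (M' \<inter> arc_between p' q'))"
proof -
  note arc = arc_between_strands[OF F AB]
  let ?X = "arc_between p q" and ?X' = "arc_between p' q'"
  have finF: "finite F" using F unfolding strand_family_def by simp
  have pF: "fst p = fst q" "fst p' = fst q'"
    using p q AB(4) by (cases A; cases B; auto simp: mem_on)+
  have rest: "even (card (M \<inter> ?X \<inter> closed_strand S)) \<longleftrightarrow> even (card (M' \<inter> ?X' \<inter> closed_strand S))"
    if S: "S \<in> F - {A} - {B}" for S
  proof -
    have nS: "closed_strand A \<inter> closed_strand S = {}" "closed_strand B \<inter> closed_strand S = {}"
      using S AB strand_family_disjoint[OF F] by blast+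
    have "p \<notin> closed_strand S" "q \<notin> closed_strand S"
      using p q nS on_subset_closed_strand by blast+
    then have "closed_strand S \<subseteq> ?X \<or> closed_strand S \<inter> ?X = {}"
      using strand_in_arc_cases[OF F _ pF(1)] S by blast
    moreover have "closed_strand S \<inter> ?X = closed_strand S \<inter> ?X'"
      using arc(3)[OF p(1) q(1) p(2) q(2)] nS by blast
    ultimately have "(\<forall>N. N \<inter> ?X \<inter> closed_strand S = N \<inter> closed_strand S \<and>
          N \<inter> ?X' \<inter> closed_strand S = N \<inter> closed_strand S) \<or>
        (\<forall>N. N \<inter> ?X \<inter> closed_strand S = {} \<and> N \<inter> ?X' \<inter> closed_strand S = {})" by blast
    then show ?thesis using par[of S] S by (elim disjE) simp_all
  qed
  have A: "N \<inter> ?X \<inter> closed_strand A = {m \<in> N \<inter> closed_strand A. snd p < snd m}"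
    "N \<inter> ?X' \<inter> closed_strand A = {m \<in> N \<inter> closed_strand A. snd p' < snd m}" for N
    using arc(1) p q by blast+
  have B: "N \<inter> ?X \<inter> closed_strand B = {m \<in> N \<inter> closed_strand B. snd m < snd q}"
    "N \<inter> ?X' \<inter> closed_strand B = {m \<in> N \<inter> closed_strand B. snd m < snd q'}" for N
    using arc(2) p q by blast+
  have sumF: "sum f F = f A + (f B + sum f (F - {A} - {B}))" for f :: "strand \<Rightarrow> nat"
    using finF AB by (simp add: sum.remove[of F A] sum.remove[of "F - {A}" B])
  have "even (\<Sum>S\<in>F - {A} - {B}. card (M \<inter> ?X \<inter> closed_strand S)) \<longleftrightarrow>
      even (\<Sum>S\<in>F - {A} - {B}. card (M' \<inter> ?X' \<inter> closed_strand S))"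
    using rest by (rule even_sum_cong)
  then have "even (\<Sum>S\<in>F. card (M \<inter> ?X \<inter> closed_strand S)) \<longleftrightarrow>
      even (\<Sum>S\<in>F. card (M' \<inter> ?X' \<inter> closed_strand S))"
    unfolding sumF A B using ends by (simp only: even_add) blast
  moreover have "m \<in> ?X \<longleftrightarrow> m \<in> ?X'" if "m \<notin> covered F" for m
    using arc(3)[OF p(1) q(1) p(2) q(2)] that AB by blast
  then have "M \<inter> ?X - covered F = M' \<inter> ?X' - covered F" using out by blast
  ultimately show ?thesis
    using card_split_by_strands[OF F, of "M \<inter> ?X"] card_split_by_strands[OF F, of "M' \<inter> ?X'"] fin
    by simp
qed

section \<open>Weights of the arcs at a crossing\<close>

definition marks_ahead :: "passage set \<Rightarrow> strand \<Rightarrow> passage \<Rightarrow> nat" where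
  "marks_ahead M S p = card {m \<in> M \<inter> closed_strand S. snd p < snd m}"

definition marks_behind :: "passage set \<Rightarrow> strand \<Rightarrow> passage \<Rightarrow> nat" where
  "marks_behind M S p = card {m \<in> M \<inter> closed_strand S. snd m < snd p}"

text \<open>
  This is what a local move leaves unchanged on the level of counts: all marks outside the strands,
  and their numbers modulo 2 on each strand.  The geometry of the disc is not mentioned, and with
  \<open>D = D'\<close> the lemmas that follow compare two crossings of the same diagram.
\<close>

definition parity_matched :: "strand set \<Rightarrow> diagram \<Rightarrow> diagram \<Rightarrow> bool" where
  "parity_matched F D D' \<longleftrightarrow>
     crossing_passages D - covered F = crossing_passages D' - covered F \<and>
     bars D - covered F = bars D' - covered F \<and>
     (\<forall>S\<in>F. (even (card (crossing_passages D \<inter> closed_strand S)) \<longleftrightarrow>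
            even (card (crossing_passages D' \<inter> closed_strand S))) \<and>
         (even (card (bars D \<inter> closed_strand S)) \<longleftrightarrow> even (card (bars D' \<inter> closed_strand S))))"

lemma parity_matched_refl: "parity_matched F D D"
  unfolding parity_matched_def by simp

lemma component_weight_outside:
  assumes "strand_family F" "twisted_diagram D" "twisted_diagram D'" "parity_matched F D D'"
    and "fst p = fst q" "p \<notin> covered F" "q \<notin> covered F"
  shows "component_weight D (arc_between p q) = component_weight D' (arc_between p q)"
  using assms
  by (intro component_weight_cong even_card_arc_outside[of F])
    (auto simp: parity_matched_def finite_crossing_passages twisted_diagramD(2))

lemma component_weight_between_strands:
  assumes "strand_family F" "twisted_diagram D" "twisted_diagram D'" "parity_matched F D D'"
    and "A \<in> F" "B \<in> F" "A \<noteq> B" "fst A = fst B"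
    and "p \<in> on A" "p' \<in> on A" "q \<in> on B" "q' \<in> on B"
    and "even (marks_ahead (crossing_passages D) A p + marks_behind (crossing_passages D) B q) \<longleftrightarrow>
      even (marks_ahead (crossing_passages D') A p' + marks_behind (crossing_passages D') B q')"
    and "even (marks_ahead (bars D) A p + marks_behind (bars D) B q) \<longleftrightarrow>
      even (marks_ahead (bars D') A p' + marks_behind (bars D') B q')"
  shows "component_weight D (arc_between p q) = component_weight D' (arc_between p' q')"
  using assms
  by (intro component_weight_cong even_card_arc_between_strands[of F _ _ A B])
    (auto simp: parity_matched_def finite_crossing_passages twisted_diagramD(2)
      marks_ahead_def marks_behind_def)

lemma filter_insert:
  "{m \<in> insert a S. P m} = (if P a then insert a {m \<in> S. P m} else {m \<in> S. P m})"
  by auto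

lemma marks_none:
  assumes "M \<inter> closed_strand S = {}"
  shows "marks_ahead M S p = 0" "marks_behind M S p = 0"
  unfolding marks_ahead_def marks_behind_def assms by simp_all

lemma marks_single:
  assumes "M \<inter> closed_strand S = {p}"
  shows "marks_ahead M S p = 0" "marks_behind M S p = 0"
  unfolding marks_ahead_def marks_behind_def assms by (simp_all add: filter_insert)

lemma marks_pair:
  assumes "M \<inter> closed_strand S = {p, q}" "snd p \<noteq> snd q"
  shows "marks_ahead M S p = of_bool (snd p < snd q)" "marks_behind M S p = of_bool (\<not> snd p < snd q)"
  unfolding marks_ahead_def marks_behind_def assms(1) filter_insert using assms(2) by auto

lemma marks_straddling:
  assumes "M \<inter> closed_strand S = {a, b}" "strictly_between a p b"
  shows "marks_ahead M S p = 1" "marks_behind M S p = 1"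
  unfolding marks_ahead_def marks_behind_def assms(1) filter_insert
  using assms(2) by (auto simp: strictly_between_def)

text \<open>
  Besides \<open>x\<close>, each of the two strands has one more classical passage, \<open>a\<close> on \<open>A\<close> and \<open>b\<close> on
  \<open>B\<close>.  The over arc of \<open>x\<close> contains \<open>a\<close> iff \<open>a\<close> comes after \<open>x\<close>, and it contains \<open>b\<close> iff
  \<open>b\<close> comes before \<open>x\<close>; so the number of those it contains is even iff \<open>a\<close> and \<open>b\<close> are both
  ahead of \<open>x\<close> or both behind it.  The assumption \<open>order\<close> says that this is the same for \<open>x'\<close>,
  and it covers the second and the third Reidemeister move at once.
\<close>

lemma component_weights_two_crossings_per_strand:
  assumes F: "strand_family F" "twisted_diagram D" "twisted_diagram D'" "parity_matched F D D'"
    and AB: "A \<in> F" "B \<in> F" "A \<noteq> B" "fst A = fst B"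
    and x: "x \<in> on A \<times> on B" "x' \<in> on A \<times> on B"
    and A: "crossing_passages D \<inter> closed_strand A = {fst x, a}" "snd (fst x) \<noteq> snd a"
      "crossing_passages D' \<inter> closed_strand A = {fst x', a'}" "snd (fst x') \<noteq> snd a'"
    and B: "crossing_passages D \<inter> closed_strand B = {snd x, b}" "snd (snd x) \<noteq> snd b"
      "crossing_passages D' \<inter> closed_strand B = {snd x', b'}" "snd (snd x') \<noteq> snd b'"
    and bars: "bars D \<inter> closed_strand A = {}" "bars D \<inter> closed_strand B = {}"
      "bars D' \<inter> closed_strand A = {}" "bars D' \<inter> closed_strand B = {}"
    and order: "(snd (fst x) < snd a \<longleftrightarrow> snd (snd x) < snd b) \<longleftrightarrow>
      (snd (fst x') < snd a' \<longleftrightarrow> snd (snd x') < snd b')"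
  shows "component_weight D (over_component x) = component_weight D' (over_component x')"
    and "component_weight D (under_component x) = component_weight D' (under_component x')"
proof -
  note marks = marks_none[OF bars(1)] marks_none[OF bars(2)] marks_none[OF bars(3)] marks_none[OF bars(4)]
    marks_pair[OF A(1,2)] marks_pair[OF A(3,4)] marks_pair[OF B(1,2)] marks_pair[OF B(3,4)]
  have on: "fst x \<in> on A" "fst x' \<in> on A" "snd x \<in> on B" "snd x' \<in> on B" using x by auto
  show "component_weight D (over_component x) = component_weight D' (over_component x')"
    unfolding over_component_def
    by (rule component_weight_between_strands[OF F AB on]; use order in \<open>auto simp: marks\<close>)
  show "component_weight D (under_component x) = component_weight D' (under_component x')"
    unfolding under_component_def
    by (rule component_weight_between_strands[OF F AB(2,1) AB(3)[symmetric] AB(4)[symmetric] on(3,4,1,2)];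
        use order in \<open>auto simp: marks\<close>)
qed

lemma contribution_eqI:
  assumes "fst (fst x) = fst (snd x) \<longleftrightarrow> fst (fst x') = fst (snd x')"
    and "crossing_sign D' x' = crossing_sign D x"
    and "fst (fst x) = fst (snd x) \<Longrightarrow>
      component_weight D (over_component x) = component_weight D' (over_component x') \<and>
      component_weight D (under_component x) = component_weight D' (under_component x')"
  shows "contribution D x = contribution D' x'"
  using assms unfolding contribution_def by auto

lemma on_fst: "p \<in> on S \<Longrightarrow> fst p = fst S"
  by (cases S) (simp add: mem_on)

section \<open>Replacing a tangle\<close>

lemma loop_has_vector_derivative:
  assumes "twisted_diagram D" "i < comps D"
  shows "(loop D i has_vector_derivative vector_derivative (loop D i) (at r)) (at r)"
  using assms unfolding twisted_diagram_def C1_differentiable_on_eq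
  by (auto simp: vector_derivative_works)

text \<open>
  The loops agree at the parameters in \<open>[0, 1)\<close> that are not covered by strands.  To compare the
  derivatives, they have to agree on a neighbourhood; at the parameter 0 this neighbourhood extends
  to negative parameters, where periodicity is used.
\<close>

lemma tangent_eq_outside_strands:
  assumes D: "twisted_diagram D" and D': "twisted_diagram D'" and comps: "comps D' = comps D"
    and F: "strand_family F"
    and agree: "\<And>p. p \<in> passages D \<Longrightarrow> p \<notin> covered F \<Longrightarrow> pt D' p = pt D p"
    and p: "p \<in> passages D" "p \<notin> covered F"
  shows "tangent D' p = tangent D p"
proof -
  define i where "i = fst p"
  have i: "i < comps D" and r: "0 \<le> snd p" "snd p < 1" using p unfolding passages_def i_def by auto
  define K where "K = (\<Union>S\<in>F. {t. (i, t) \<in> closed_strand S})"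
  have "closed {t. (i, t) \<in> closed_strand S}" for S
  proof -
    obtain j a b where [simp]: "S = (j, a, b)" by (cases S)
    have "{t. (i, t) \<in> closed_strand S} = (if j = i then {a..b} else {})"
      by (auto simp: mem_closed_strand)
    then show ?thesis by simp
  qed
  then have K: "closed K" unfolding K_def
    using F by (intro closed_UN) (auto simp: strand_family_def)
  have K01: "0 < t \<and> t < 1" if "t \<in> K" for t
    using that F unfolding K_def strand_family_def by (force simp: mem_closed_strand)
  \<comment> \<open>The loops agree on \<open>U\<close>: the third set takes care of the negative parameters \<open>t\<close>, where the
    loops are compared at \<open>t + 1\<close>.\<close>
  define U where "U = {-1<..<1} - K - (\<lambda>t. t + 1) -` K"
  have "closed ((\<lambda>t. t + 1) -` K)"
    by (rule closed_vimage[OF K]) (intro continuous_intros)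
  then have "open U" unfolding U_def by (intro open_Diff K open_greaterThanLessThan)
  have per: "loop E i (t + 1) = loop E i t" if "twisted_diagram E" "i < comps E" for E t
    using that unfolding twisted_diagram_def by simp
  have base: "loop D i t = loop D' i t" if "0 \<le> t" "t < 1" "t \<notin> K" for t
    using agree[of "(i, t)"] that i unfolding passages_def pt_def K_def by auto
  have "loop D i t = loop D' i t" if "t \<in> U" for t
  proof (cases "0 \<le> t")
    case True
    then show ?thesis using base[of t] that unfolding U_def by simp
  next
    case False
    then show ?thesis
      using base[of "t + 1"] that per[OF D i] per[OF D', of t] i comps unfolding U_def by simp
  qed
  moreover have "snd p \<in> U" unfolding U_def
    using r p(2) K01[of "snd p + 1"] by (force simp: K_def i_def)
  ultimately have "(loop D' i has_vector_derivative vector_derivative (loop D i) (at (snd p))) (at (snd p))"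
    using has_vector_derivative_transform_within_open[OF loop_has_vector_derivative[OF D i] \<open>open U\<close>]
    by blast
  then show ?thesis unfolding tangent_def i_def[symmetric] by (rule vector_derivative_at)
qed

text \<open>
  Applied to the set \<open>U\<close> of covered passages: both passages of a crossing are at the same point, so
  either both are in the disc or none.
\<close>

lemma Field_saturated:
  assumes "\<And>c. c \<in> R \<Longrightarrow> snd c \<in> U \<longleftrightarrow> fst c \<in> U"
  shows "Field R \<inter> U = Field {c \<in> R. fst c \<in> U}" "Field R - U = Field {c \<in> R. fst c \<notin> U}"
proof -
  have Field: "p \<in> Field Q \<longleftrightarrow> (\<exists>q. (p, q) \<in> Q \<or> (q, p) \<in> Q)" for p and Q :: "('a \<times> 'a) set"
    unfolding Field_def by blast
  have sat: "(p, q) \<in> R \<Longrightarrow> q \<in> U \<longleftrightarrow> p \<in> U" for p q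
    using assms[of "(p, q)"] by simp
  show "Field R \<inter> U = Field {c \<in> R. fst c \<in> U}" "Field R - U = Field {c \<in> R. fst c \<notin> U}"
    by (rule set_eqI, simp add: Field, use sat in blast)+
qed

locale tangle_replacement =
  fixes D D' :: diagram and \<Delta> :: "(real^2) set" and Ss :: "strand list"
    and cl vi cl' vi' :: "(passage \<times> passage) set" and bs bs' :: "passage set"
  assumes change: "local_change D D' \<Delta> Ss"
    and old: "tangle D \<Delta> cl vi bs" and new: "tangle D' \<Delta> cl' vi' bs'"
begin

abbreviation "F \<equiv> set Ss"

lemma twisted: "twisted_diagram D" "twisted_diagram D'"
  using change unfolding local_change_def by auto

lemma passages_eq: "passages D' = passages D"
  using change unfolding local_change_def passages_def by simp

lemma family: "strand_family F"
  using change unfolding local_change_def meets_in_strands_def strand_family_def by auto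

lemma distinct_strands: "distinct Ss"
  using change unfolding local_change_def meets_in_strands_def by auto

lemma in_disc_iff:
  assumes "p \<in> passages D"
  shows "pt D p \<in> \<Delta> \<longleftrightarrow> p \<in> covered F" "pt D' p \<in> \<Delta> \<longleftrightarrow> p \<in> covered F"
  using change assms passages_eq unfolding local_change_def meets_in_strands_def by auto

lemma pt_outside: "p \<in> passages D \<Longrightarrow> p \<notin> covered F \<Longrightarrow> pt D' p = pt D p"
  using change on_subset_closed_strand unfolding local_change_def by blast

lemma classical_in_passages: "c \<in> classical D \<union> classical D' \<Longrightarrow> fst c \<in> passages D \<and> snd c \<in> passages D"
  using classicalD twisted passages_eq by blast

lemma snd_covered_iff:
  "c \<in> classical D \<union> classical D' \<Longrightarrow> snd c \<in> covered F \<longleftrightarrow> fst c \<in> covered F"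
  using classicalD(4)[OF twisted(1), of c] classicalD(4)[OF twisted(2), of c]
    classical_in_passages[of c] in_disc_iff[of "fst c"] in_disc_iff[of "snd c"] by auto

lemma crossing_in_disc_iff:
  "c \<in> classical D \<Longrightarrow> pt D (fst c) \<in> \<Delta> \<longleftrightarrow> fst c \<in> covered F"
  "c \<in> classical D' \<Longrightarrow> pt D' (fst c) \<in> \<Delta> \<longleftrightarrow> fst c \<in> covered F"
  using classical_in_passages[of c] in_disc_iff[of "fst c"] by simp_all

lemma inner_crossings:
  "{c \<in> classical D. fst c \<in> covered F} = cl" "{c \<in> classical D'. fst c \<in> covered F} = cl'"
proof -
  have "cl = {c \<in> classical D. pt D (fst c) \<in> \<Delta>}" "cl' = {c \<in> classical D'. pt D' (fst c) \<in> \<Delta>}"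
    using old new unfolding tangle_def by simp_all
  then show "{c \<in> classical D. fst c \<in> covered F} = cl" "{c \<in> classical D'. fst c \<in> covered F} = cl'"
    by (simp_all add: crossing_in_disc_iff cong: conj_cong)
qed

lemma outer_crossings:
  "{c \<in> classical D'. fst c \<notin> covered F} = {c \<in> classical D. fst c \<notin> covered F}"
proof -
  have "{c \<in> classical D'. fst c \<notin> covered F} = {c \<in> classical D'. pt D' (fst c) \<notin> \<Delta>}"
    "{c \<in> classical D. fst c \<notin> covered F} = {c \<in> classical D. pt D (fst c) \<notin> \<Delta>}"
    by (simp_all add: crossing_in_disc_iff cong: conj_cong)
  then show ?thesis using change unfolding local_change_def by simp
qed

lemma crossing_passages_outside:
  "crossing_passages D - covered F = crossing_passages D' - covered F"
  unfolding crossing_passages_def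
  using Field_saturated(2)[of "classical D" "covered F"] Field_saturated(2)[of "classical D'" "covered F"]
    snd_covered_iff outer_crossings by simp

lemma bars_outside: "bars D - covered F = bars D' - covered F"
proof -
  have "bars D - covered F = {p \<in> bars D. pt D p \<notin> \<Delta>}" "bars D' - covered F = {p \<in> bars D'. pt D' p \<notin> \<Delta>}"
    using twisted_diagramD(3)[OF twisted(1)] twisted_diagramD(3)[OF twisted(2)] passages_eq in_disc_iff
    by blast+
  then show ?thesis using change unfolding local_change_def by simp
qed

lemma crossing_passages_inside:
  assumes "S \<in> F"
  shows "crossing_passages D \<inter> closed_strand S = Field cl \<inter> closed_strand S"
    and "crossing_passages D' \<inter> closed_strand S = Field cl' \<inter> closed_strand S"
proof -
  have "crossing_passages D \<inter> covered F = Field cl" "crossing_passages D' \<inter> covered F = Field cl'"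
    unfolding crossing_passages_def
    using Field_saturated(1)[of "classical D" "covered F"] Field_saturated(1)[of "classical D'" "covered F"]
      snd_covered_iff inner_crossings by simp_all
  then show "crossing_passages D \<inter> closed_strand S = Field cl \<inter> closed_strand S"
    and "crossing_passages D' \<inter> closed_strand S = Field cl' \<inter> closed_strand S"
    using assms by blast+
qed

lemma bars_inside:
  assumes "S \<in> F"
  shows "bars D \<inter> closed_strand S = bs \<inter> closed_strand S"
    and "bars D' \<inter> closed_strand S = bs' \<inter> closed_strand S"
proof -
  have "bs = {p \<in> bars D. pt D p \<in> \<Delta>}" "bs' = {p \<in> bars D'. pt D' p \<in> \<Delta>}"
    using old new unfolding tangle_def by auto
  then have "bs = bars D \<inter> covered F" "bs' = bars D' \<inter> covered F"
    using twisted_diagramD(3)[OF twisted(1)] twisted_diagramD(3)[OF twisted(2)] passages_eq in_disc_iff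
    by blast+
  then show "bars D \<inter> closed_strand S = bs \<inter> closed_strand S"
    and "bars D' \<inter> closed_strand S = bs' \<inter> closed_strand S" using assms by auto
qed

lemma crossing_sign_outside:
  assumes "c \<in> classical D" "fst c \<notin> covered F"
  shows "crossing_sign D' c = crossing_sign D c"
proof -
  have "comps D' = comps D" using change unfolding local_change_def by simp
  note tan = tangent_eq_outside_strands[OF twisted this family pt_outside]
  have "tangent D' (fst c) = tangent D (fst c)" "tangent D' (snd c) = tangent D (snd c)"
    using assms classical_in_passages[of c] snd_covered_iff[of c] by (auto intro!: tan)
  then show ?thesis by (simp add: crossing_sign_def tangent_det_def)
qed

lemma parity_matchedI:
  assumes "\<And>S. S \<in> F \<Longrightarrow> even (card (Field cl \<inter> closed_strand S)) \<longleftrightarrow> even (card (Field cl' \<inter> closed_strand S))"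
    and "\<And>S. S \<in> F \<Longrightarrow> even (card (bs \<inter> closed_strand S)) \<longleftrightarrow> even (card (bs' \<inter> closed_strand S))"
  shows "parity_matched F D D'"
  unfolding parity_matched_def
  using assms crossing_passages_inside bars_inside crossing_passages_outside bars_outside by auto

text \<open>
  Crossings outside the disc contribute the same before and after the move, which leaves a
  comparison of finitely many crossings inside.
\<close>

lemma Q_poly_eqI:
  assumes match: "parity_matched F D D'"
    and inner: "(\<Sum>c\<in>cl. contribution D c) = (\<Sum>c\<in>cl'. contribution D' c)"
  shows "Q_poly D = Q_poly D'"
proof -
  let ?out = "{c \<in> classical D. fst c \<notin> covered F}"
  have outer: "contribution D c = contribution D' c" if c: "c \<in> ?out" for c
  proof (rule contribution_eqI)
    show "crossing_sign D' c = crossing_sign D c" using c crossing_sign_outside by simp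
    assume "fst (fst c) = fst (snd c)"
    moreover have "fst c \<notin> covered F" "snd c \<notin> covered F" using c snd_covered_iff[of c] by auto
    ultimately show "component_weight D (over_component c) = component_weight D' (over_component c) \<and>
      component_weight D (under_component c) = component_weight D' (under_component c)"
      unfolding over_component_def under_component_def
      using component_weight_outside[OF family twisted match] by simp
  qed simp
  have split: "(\<Sum>c\<in>C. f c) = (\<Sum>c\<in>{c \<in> C. fst c \<in> covered F}. f c) + (\<Sum>c\<in>{c \<in> C. fst c \<notin> covered F}. f c)"
    if "finite C" for C and f :: "passage \<times> passage \<Rightarrow> int poly poly"
  proof -
    have "C \<inter> {c. fst c \<in> covered F} = {c \<in> C. fst c \<in> covered F}"
      "C - {c. fst c \<in> covered F} = {c \<in> C. fst c \<notin> covered F}" by blast+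
    then show ?thesis using sum.Int_Diff[OF that, of f "{c. fst c \<in> covered F}"] by simp
  qed
  have "Q_poly D = (\<Sum>c\<in>cl. contribution D c) + (\<Sum>c\<in>?out. contribution D c)"
    unfolding Q_poly_eq_sum_contribution[OF twisted(1)] inner_crossings(1)[symmetric]
    by (rule split) (rule twisted_diagramD(1)[OF twisted(1)])
  moreover have "Q_poly D' = (\<Sum>c\<in>cl'. contribution D' c) + (\<Sum>c\<in>?out. contribution D' c)"
    unfolding Q_poly_eq_sum_contribution[OF twisted(2)] inner_crossings(2)[symmetric] outer_crossings[symmetric]
    by (rule split) (rule twisted_diagramD(1)[OF twisted(2)])
  moreover have "(\<Sum>c\<in>?out. contribution D c) = (\<Sum>c\<in>?out. contribution D' c)"
    using outer by (rule sum.cong[OF refl])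
  ultimately show ?thesis using inner by simp
qed

lemma on_one_strand: "p \<in> on S \<Longrightarrow> S \<in> F \<Longrightarrow> T \<in> F \<Longrightarrow> p \<in> closed_strand T \<longleftrightarrow> S = T"
  using strand_family_disjoint[OF family, of S T p] on_subset_closed_strand by blast

end

section \<open>The local moves\<close>

lemma Field_insert_pair: "Field (insert c R) = insert (fst c) (insert (snd c) (Field R))"
  by (cases c) (auto simp: Field_def)

lemma no_classical_change:
  assumes "local_change D D' \<Delta> Ss" "tangle D \<Delta> {} vi bs" "tangle D' \<Delta> {} vi' bs'"
    and "\<And>S. S \<in> set Ss \<Longrightarrow> even (card (bs \<inter> closed_strand S)) \<longleftrightarrow> even (card (bs' \<inter> closed_strand S))"
  shows "Q_poly D = Q_poly D'"
proof -
  interpret tangle_replacement D D' \<Delta> Ss "{}" vi "{}" vi' bs bs'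
    using assms(1-3) by unfold_locales
  show ?thesis using assms(4) by (intro Q_poly_eqI parity_matchedI) simp_all
qed

lemma virtual_moves_Q_poly:
  assumes "virtual_1 D D' \<or> virtual_2 D D' \<or> virtual_3 D D'"
  shows "Q_poly D = Q_poly D'"
  using assms unfolding virtual_1_def virtual_2_def virtual_3_def triangle_change_def
  by (auto intro: no_classical_change)

lemma twisted_1_Q_poly:
  assumes "twisted_1 D D'"
  shows "Q_poly D = Q_poly D'"
proof -
  obtain \<Delta> A B x x' b b' where c: "local_change D D' \<Delta> [A, B]" "tangle D \<Delta> {} {x} {b}"
    "tangle D' \<Delta> {} {x'} {b'}" and b: "b \<in> on A" "b' \<in> on A"
    using assms unfolding twisted_1_def by blast
  interpret tangle_replacement D D' \<Delta> "[A, B]" "{}" "{x}" "{}" "{x'}" "{b}" "{b'}"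
    using c by unfold_locales
  show ?thesis using b by (intro no_classical_change[OF c]) (auto simp: on_one_strand Int_insert_left)
qed

lemma twisted_2_Q_poly:
  assumes "twisted_2 D D'"
  shows "Q_poly D = Q_poly D'"
proof -
  obtain \<Delta> A b b' where c: "local_change D D' \<Delta> [A]" "tangle D \<Delta> {} {} {}"
    "tangle D' \<Delta> {} {} {b, b'}" and b: "b \<in> on A" "b' \<in> on A" "b \<noteq> b'"
    using assms unfolding twisted_2_def by blast
  show ?thesis using b by (intro no_classical_change[OF c]) (auto simp: on_subset_closed_strand)
qed

text \<open>
  The kink: whichever of the two passages of the new crossing comes first, the arc from it to the
  other one lies in the strand and carries no mark, so its weight is \<open>1 - 1\<close>.
\<close>

lemma reidemeister_1_Q_poly:
  assumes "reidemeister_1 D D'"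
  shows "Q_poly D = Q_poly D'"
proof -
  obtain \<Delta> A x where c: "local_change D D' \<Delta> [A]" "tangle D \<Delta> {} {} {}" "tangle D' \<Delta> {x} {} {}"
    and x: "fst x \<in> on A" "snd x \<in> on A"
    using assms unfolding reidemeister_1_def by (auto simp: mem_Times_iff)
  interpret tangle_replacement D D' \<Delta> "[A]" "{}" "{}" "{x}" "{}" "{}" "{}"
    using c by unfold_locales
  have "x \<in> classical D'" using inner_crossings(2) by auto
  then have ne: "fst x \<noteq> snd x" using classicalD(3)[OF twisted(2)] by blast
  have A: "crossing_passages D' \<inter> closed_strand A = {fst x, snd x}" "bars D' \<inter> closed_strand A = {}"
    using crossing_passages_inside(2)[of A] bars_inside(2)[of A] x
    by (auto simp: Field_insert_pair on_subset_closed_strand)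
  have trivial_arc: "component_weight D' (arc_between p q) = 0"
    if pq: "{p, q} = {fst x, snd x}" "snd p < snd q" for p q
  proof -
    have "p \<in> on A" "q \<in> on A" using pq x by (auto simp: doubleton_eq_iff)
    then have "arc_between p q \<subseteq> closed_strand A - {p, q}"
      using pq(2) by (cases A) (auto simp: mem_arc_between mem_on mem_closed_strand)
    then have "crossing_passages D' \<inter> arc_between p q \<subseteq> {fst x, snd x} - {p, q}"
      "bars D' \<inter> arc_between p q \<subseteq> {}" using A by blast+
    then have "crossing_passages D' \<inter> arc_between p q = {}" "bars D' \<inter> arc_between p q = {}"
      using pq(1) by simp_all
    then show ?thesis
      by (simp add: component_weight_def index_parity_def bar_parity_def odd_flat_index_iff[OF twisted(2)])
  qed
  have "fst (fst x) = fst (snd x)" using x on_fst by simp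
  then have "snd (fst x) \<noteq> snd (snd x)" using ne by (simp add: prod_eq_iff)
  then have "snd (fst x) < snd (snd x) \<or> snd (snd x) < snd (fst x)" by linarith
  then have "contribution D' x = 0"
    using trivial_arc[of "fst x" "snd x"] trivial_arc[of "snd x" "fst x"]
    unfolding contribution_def over_component_def under_component_def by (auto simp: insert_commute)
  moreover have "parity_matched F D D'"
    using x ne by (intro parity_matchedI) (simp_all add: Field_insert_pair on_one_strand)
  ultimately show ?thesis by (intro Q_poly_eqI) simp_all
qed

text \<open>
  Here the diagram \<open>D'\<close> is compared with itself, at its two crossings in the disc: \<open>y\<close> is the other
  crossing for \<open>x\<close>, and \<open>x\<close> for \<open>y\<close>, so both order relations are reversed when \<open>x\<close> and \<open>y\<close> are
  exchanged.
\<close>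

lemma reidemeister_2_Q_poly:
  assumes "reidemeister_2 D D'"
  shows "Q_poly D = Q_poly D'"
proof -
  obtain \<Delta> A B x y where c: "local_change D D' \<Delta> [A, B]" "tangle D \<Delta> {} {} {}" "tangle D' \<Delta> {x, y} {} {}"
    and x: "x \<in> on A \<times> on B" and y: "y \<in> on A \<times> on B" and "x \<noteq> y"
    and sign: "crossing_sign D' x = - crossing_sign D' y"
    using assms unfolding reidemeister_2_def by blast
  interpret tangle_replacement D D' \<Delta> "[A, B]" "{}" "{}" "{x, y}" "{}" "{}" "{}"
    using c by unfold_locales
  have on: "fst x \<in> on A" "snd x \<in> on B" "fst y \<in> on A" "snd y \<in> on B" using x y by auto
  have "A \<noteq> B" using distinct_strands by simp
  have "fst x \<noteq> fst y" "snd x \<noteq> snd y"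
    using distinct_crossings_distinct_passages[OF twisted(2) _ _ \<open>x \<noteq> y\<close>] inner_crossings(2) by auto
  then have neq: "snd (fst x) \<noteq> snd (fst y)" "snd (snd x) \<noteq> snd (snd y)"
    using on on_fst by (auto simp: prod_eq_iff)
  have A: "crossing_passages D' \<inter> closed_strand A = {fst x, fst y}" "bars D' \<inter> closed_strand A = {}"
    and B: "crossing_passages D' \<inter> closed_strand B = {snd x, snd y}" "bars D' \<inter> closed_strand B = {}"
    using crossing_passages_inside(2)[of A] bars_inside(2)[of A]
      crossing_passages_inside(2)[of B] bars_inside(2)[of B] on \<open>A \<noteq> B\<close>
    by (simp_all add: Field_insert_pair on_one_strand)
  have "contribution D' x = - contribution D' y"
  proof (cases "fst A = fst B")
    case True
    have A': "crossing_passages D' \<inter> closed_strand A = {fst y, fst x}"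
      and B': "crossing_passages D' \<inter> closed_strand B = {snd y, snd x}"
      using A B by (simp_all add: insert_commute)
    have "component_weight D' (over_component x) = component_weight D' (over_component y)"
      "component_weight D' (under_component x) = component_weight D' (under_component y)"
      by (rule component_weights_two_crossings_per_strand[OF family twisted(2,2) parity_matched_refl
            _ _ \<open>A \<noteq> B\<close> True x y A(1) neq(1) A' neq(1)[symmetric] B(1) neq(2) B' neq(2)[symmetric]
            A(2) B(2) A(2) B(2)]; use neq in force)+
    then show ?thesis using sign on on_fst by (simp add: contribution_def)
  next
    case False
    then show ?thesis using on on_fst by (simp add: contribution_def)
  qed
  moreover have "parity_matched F D D'"
    using on \<open>A \<noteq> B\<close> \<open>fst x \<noteq> fst y\<close> \<open>snd x \<noteq> snd y\<close>
    by (intro parity_matchedI) (auto simp: Field_insert_pair on_one_strand)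
  ultimately show ?thesis using \<open>x \<noteq> y\<close> by (intro Q_poly_eqI) simp_all
qed

lemma (in tangle_replacement) distinct_inner_passages:
  "c \<in> cl \<Longrightarrow> e \<in> cl \<Longrightarrow> c \<noteq> e \<Longrightarrow> fst c \<noteq> fst e \<and> snd c \<noteq> snd e \<and> snd c \<noteq> fst e"
  "c \<in> cl' \<Longrightarrow> e \<in> cl' \<Longrightarrow> c \<noteq> e \<Longrightarrow> fst c \<noteq> fst e \<and> snd c \<noteq> snd e \<and> snd c \<noteq> fst e"
  using distinct_crossings_distinct_passages[OF twisted(1), of c e]
    distinct_crossings_distinct_passages[OF twisted(2), of c e] inner_crossings by auto

lemma snd_neq_on_strand: "p \<in> on S \<Longrightarrow> q \<in> on S \<Longrightarrow> p \<noteq> q \<Longrightarrow> snd p \<noteq> snd q"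
  using on_fst by (metis prod_eqI)

lemma opposite_order_flip:
  assumes "opposite_order p q p' q'" "snd p \<noteq> snd q" "snd p' \<noteq> snd q'"
  shows "snd p < snd q \<longleftrightarrow> \<not> snd p' < snd q'" "snd q < snd p \<longleftrightarrow> \<not> snd q' < snd p'"
  using assms unfolding opposite_order_def by auto

lemma triangle_changeE:
  assumes "triangle_change D D' \<Delta> x y z x' y' z'"
  obtains A B C where "local_change D D' \<Delta> [A, B, C]"
    "x \<in> on A \<times> on B" "x' \<in> on A \<times> on B" "y \<in> on A \<times> on C" "y' \<in> on A \<times> on C"
    "z \<in> on B \<times> on C" "z' \<in> on B \<times> on C"
    "opposite_order (fst x) (fst y) (fst x') (fst y')"
    "opposite_order (snd x) (fst z) (snd x') (fst z')"
    "opposite_order (snd y) (snd z) (snd y') (snd z')"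
    "crossing_sign D' x' = crossing_sign D x" "crossing_sign D' y' = crossing_sign D y"
    "crossing_sign D' z' = crossing_sign D z"
  using assms unfolding triangle_change_def insert_subset by (elim exE conjE) (rule that)

text \<open>
  Corresponding crossings contribute the same.  On each of its two strands, a crossing sees
  one other classical passage, which changes sides; reversing both order relations preserves whether
  they agree.
\<close>

lemma reidemeister_3_Q_poly:
  assumes "reidemeister_3 D D'"
  shows "Q_poly D = Q_poly D'"
proof -
  obtain \<Delta> x y z x' y' z' where t: "triangle_change D D' \<Delta> x y z x' y' z'"
    and cl: "tangle D \<Delta> {x, y, z} {} {}" "tangle D' \<Delta> {x', y', z'} {} {}"
    using assms unfolding reidemeister_3_def by blast
  from t obtain A B C where c: "local_change D D' \<Delta> [A, B, C]"
    and xyz: "x \<in> on A \<times> on B" "x' \<in> on A \<times> on B" "y \<in> on A \<times> on C" "y' \<in> on A \<times> on C"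
      "z \<in> on B \<times> on C" "z' \<in> on B \<times> on C"
    and order: "opposite_order (fst x) (fst y) (fst x') (fst y')"
      "opposite_order (snd x) (fst z) (snd x') (fst z')"
      "opposite_order (snd y) (snd z) (snd y') (snd z')"
    and sign: "crossing_sign D' x' = crossing_sign D x" "crossing_sign D' y' = crossing_sign D y"
      "crossing_sign D' z' = crossing_sign D z"
    by (rule triangle_changeE)
  interpret tangle_replacement D D' \<Delta> "[A, B, C]" "{x, y, z}" "{}" "{x', y', z'}" "{}" "{}" "{}"
    using c cl by unfold_locales
  have on: "fst x \<in> on A" "snd x \<in> on B" "fst x' \<in> on A" "snd x' \<in> on B"
    "fst y \<in> on A" "snd y \<in> on C" "fst y' \<in> on A" "snd y' \<in> on C"
    "fst z \<in> on B" "snd z \<in> on C" "fst z' \<in> on B" "snd z' \<in> on C"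
    using xyz by (auto simp: mem_Times_iff)
  have ABC: "A \<noteq> B" "A \<noteq> C" "B \<noteq> C" "B \<noteq> A" "C \<noteq> A" "C \<noteq> B" using distinct_strands by auto
  have mem: "p \<in> closed_strand T \<longleftrightarrow> S = T" if "p \<in> on S" "S \<in> {A, B, C}" "T \<in> {A, B, C}" for p S T
    using on_one_strand that by simp
  have ne: "x \<noteq> y" "x \<noteq> z" "y \<noteq> z" "x' \<noteq> y'" "x' \<noteq> z'" "y' \<noteq> z'"
    using on mem ABC on_subset_closed_strand by (metis insertCI)+
  \<comment> \<open>The order relations speak of strict inequalities only; to negate them, the parameters have
    to be distinct, which holds because no two crossings share a passage.\<close>
  have neq: "snd (fst x) \<noteq> snd (fst y)" "snd (snd x) \<noteq> snd (fst z)" "snd (snd y) \<noteq> snd (snd z)"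
    "snd (fst x') \<noteq> snd (fst y')" "snd (snd x') \<noteq> snd (fst z')" "snd (snd y') \<noteq> snd (snd z')"
    using distinct_inner_passages(1)[of x y] distinct_inner_passages(1)[of x z]
      distinct_inner_passages(1)[of y z] distinct_inner_passages(2)[of x' y']
      distinct_inner_passages(2)[of x' z'] distinct_inner_passages(2)[of y' z'] ne on
    by (auto intro: snd_neq_on_strand[THEN notE])
  have A: "crossing_passages D \<inter> closed_strand A = {fst x, fst y}"
      "crossing_passages D' \<inter> closed_strand A = {fst x', fst y'}"
    and B: "crossing_passages D \<inter> closed_strand B = {snd x, fst z}"
      "crossing_passages D' \<inter> closed_strand B = {snd x', fst z'}"
    and C: "crossing_passages D \<inter> closed_strand C = {snd y, snd z}"
      "crossing_passages D' \<inter> closed_strand C = {snd y', snd z'}"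
    using on ABC crossing_passages_inside[of A] crossing_passages_inside[of B] crossing_passages_inside[of C]
    by (simp_all add: Field_insert_pair on_one_strand)
  have bars: "bars D \<inter> closed_strand S = {}" "bars D' \<inter> closed_strand S = {}" if "S \<in> {A, B, C}" for S
    using bars_inside[of S] that by auto
  have match: "parity_matched F D D'"
    using A B C neq bars crossing_passages_outside bars_outside
    by (auto simp: parity_matched_def card_insert_if)
  note swap = insert_commute[of _ _ "{}"]
  note flip = opposite_order_flip[OF order(1) neq(1,4)] opposite_order_flip[OF order(2) neq(2,5)]
    opposite_order_flip[OF order(3) neq(3,6)]
  have weights: "component_weight D (over_component c) = component_weight D' (over_component c') \<and>
      component_weight D (under_component c) = component_weight D' (under_component c')"
    if "S \<in> F" "T \<in> F" "S \<noteq> T" "fst S = fst T" "c \<in> on S \<times> on T" "c' \<in> on S \<times> on T"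
      "crossing_passages D \<inter> closed_strand S = {fst c, a}" "snd (fst c) \<noteq> snd a"
      "crossing_passages D' \<inter> closed_strand S = {fst c', a'}" "snd (fst c') \<noteq> snd a'"
      "crossing_passages D \<inter> closed_strand T = {snd c, b}" "snd (snd c) \<noteq> snd b"
      "crossing_passages D' \<inter> closed_strand T = {snd c', b'}" "snd (snd c') \<noteq> snd b'"
      "(snd (fst c) < snd a \<longleftrightarrow> snd (snd c) < snd b) \<longleftrightarrow>
      (snd (fst c') < snd a' \<longleftrightarrow> snd (snd c') < snd b')" for S T c c' a a' b b'
    using component_weights_two_crossings_per_strand[OF family twisted match that(1-14) _ _ _ _ that(15)]
      bars that(1,2) by simp
  have "contribution D x = contribution D' x'"
  proof (rule contribution_eqI[OF _ sign(1)])
    show "fst (fst x) = fst (snd x) \<longleftrightarrow> fst (fst x') = fst (snd x')" using on on_fst by simp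
    assume "fst (fst x) = fst (snd x)"
    then have "fst A = fst B" using on on_fst by simp
    then show "component_weight D (over_component x) = component_weight D' (over_component x') \<and>
      component_weight D (under_component x) = component_weight D' (under_component x')"
      using xyz ABC flip by (intro weights[of A B, OF _ _ _ _ _ _ A(1) neq(1) A(2) neq(4) B(1) neq(2) B(2) neq(5)]) auto
  qed
  moreover have "contribution D y = contribution D' y'"
  proof (rule contribution_eqI[OF _ sign(2)])
    show "fst (fst y) = fst (snd y) \<longleftrightarrow> fst (fst y') = fst (snd y')" using on on_fst by simp
    assume "fst (fst y) = fst (snd y)"
    then have "fst A = fst C" using on on_fst by simp
    then show "component_weight D (over_component y) = component_weight D' (over_component y') \<and>
      component_weight D (under_component y) = component_weight D' (under_component y')"
      using xyz ABC flip
      by (intro weights[of A C, OF _ _ _ _ _ _ A(1)[unfolded swap[of "fst x"]] neq(1)[symmetric]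
            A(2)[unfolded swap[of "fst x'"]] neq(4)[symmetric] C(1) neq(3) C(2) neq(6)]) auto
  qed
  moreover have "contribution D z = contribution D' z'"
  proof (rule contribution_eqI[OF _ sign(3)])
    show "fst (fst z) = fst (snd z) \<longleftrightarrow> fst (fst z') = fst (snd z')" using on on_fst by simp
    assume "fst (fst z) = fst (snd z)"
    then have "fst B = fst C" using on on_fst by simp
    then show "component_weight D (over_component z) = component_weight D' (over_component z') \<and>
      component_weight D (under_component z) = component_weight D' (under_component z')"
      using xyz ABC flip
      by (intro weights[of B C, OF _ _ _ _ _ _ B(1)[unfolded swap[of "snd x"]] neq(2)[symmetric]
            B(2)[unfolded swap[of "snd x'"]] neq(5)[symmetric] C(1)[unfolded swap[of "snd y"]] neq(3)[symmetric]
            C(2)[unfolded swap[of "snd y'"]] neq(6)[symmetric]]) auto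
  qed
  ultimately show ?thesis using match ne by (intro Q_poly_eqI) simp_all
qed

lemma virtual_4_Q_poly:
  assumes "virtual_4 D D'"
  shows "Q_poly D = Q_poly D'"
proof -
  obtain \<Delta> x y z x' y' z' where t: "triangle_change D D' \<Delta> x y z x' y' z'"
    and cl: "tangle D \<Delta> {z} {x, y} {}" "tangle D' \<Delta> {z'} {x', y'} {}"
    using assms unfolding virtual_4_def by blast
  from t obtain A B C where c: "local_change D D' \<Delta> [A, B, C]"
    and z: "z \<in> on B \<times> on C" "z' \<in> on B \<times> on C" and sign: "crossing_sign D' z' = crossing_sign D z"
    by (rule triangle_changeE)
  interpret tangle_replacement D D' \<Delta> "[A, B, C]" "{z}" "{x, y}" "{z'}" "{x', y'}" "{}" "{}"
    using c cl by unfold_locales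
  have on: "fst z \<in> on B" "snd z \<in> on C" "fst z' \<in> on B" "snd z' \<in> on C" using z by auto
  have ABC: "A \<noteq> B" "A \<noteq> C" "B \<noteq> C" using distinct_strands by auto
  have BC: "crossing_passages D \<inter> closed_strand B = {fst z}" "crossing_passages D' \<inter> closed_strand B = {fst z'}"
    "crossing_passages D \<inter> closed_strand C = {snd z}" "crossing_passages D' \<inter> closed_strand C = {snd z'}"
    "crossing_passages D \<inter> closed_strand A = {}" "crossing_passages D' \<inter> closed_strand A = {}"
    using on ABC crossing_passages_inside[of A] crossing_passages_inside[of B] crossing_passages_inside[of C]
    by (simp_all add: Field_insert_pair on_one_strand)
  have bars: "bars D \<inter> closed_strand S = {}" "bars D' \<inter> closed_strand S = {}" if "S \<in> {A, B, C}" for S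
    using bars_inside[of S] that by auto
  have match: "parity_matched F D D'"
    using BC bars crossing_passages_outside bars_outside by (auto simp: parity_matched_def)
  have "contribution D z = contribution D' z'"
  proof (rule contribution_eqI[OF _ sign])
    show "fst (fst z) = fst (snd z) \<longleftrightarrow> fst (fst z') = fst (snd z')" using on on_fst by simp
    assume "fst (fst z) = fst (snd z)"
    then have BC': "fst B = fst C" using on on_fst by simp
    note marks = marks_single[OF BC(1)] marks_single[OF BC(2)] marks_single[OF BC(3)] marks_single[OF BC(4)]
      marks_none[OF bars(1)] marks_none[OF bars(2)]
    show "component_weight D (over_component z) = component_weight D' (over_component z') \<and>
      component_weight D (under_component z) = component_weight D' (under_component z')"
      unfolding over_component_def under_component_def
      using on ABC BC' component_weight_between_strands[OF family twisted match, of B C "fst z" "fst z'" "snd z" "snd z'"]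
        component_weight_between_strands[OF family twisted match, of C B "snd z" "snd z'" "fst z" "fst z'"]
      by (simp add: marks)
  qed
  then show ?thesis using match by (intro Q_poly_eqI) simp_all
qed

text \<open>
  The crossing keeps its sign, but over and under strand are exchanged, so the over arc of \<open>x\<close> is to
  be compared with the under arc of \<open>x'\<close>.  The former has one of the bars of \<open>A\<close> and one of the
  bars of \<open>B\<close>, the latter has none of them.
\<close>

lemma twisted_3_Q_poly:
  assumes "twisted_3 D D'"
  shows "Q_poly D = Q_poly D'"
proof -
  obtain \<Delta> A B x a1 a2 b1 b2 x' v w where c: "local_change D D' \<Delta> [A, B]"
    "tangle D \<Delta> {x} {} {a1, a2, b1, b2}" "tangle D' \<Delta> {x'} {v, w} {}"
    and x: "x \<in> on A \<times> on B" "x' \<in> on B \<times> on A"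
    and ab: "a1 \<in> on A" "a2 \<in> on A" "b1 \<in> on B" "b2 \<in> on B"
    and btw: "strictly_between a1 (fst x) a2" "strictly_between b1 (snd x) b2"
    and sign: "crossing_sign D' x' = crossing_sign D x"
    using assms unfolding twisted_3_def by blast
  interpret tangle_replacement D D' \<Delta> "[A, B]" "{x}" "{}" "{x'}" "{v, w}" "{a1, a2, b1, b2}" "{}"
    using c by unfold_locales
  have on: "fst x \<in> on A" "snd x \<in> on B" "snd x' \<in> on A" "fst x' \<in> on B" using x by auto
  have AB: "A \<noteq> B" "B \<noteq> A" using distinct_strands by auto
  have crossings: "crossing_passages D \<inter> closed_strand A = {fst x}" "crossing_passages D' \<inter> closed_strand A = {snd x'}"
    "crossing_passages D \<inter> closed_strand B = {snd x}" "crossing_passages D' \<inter> closed_strand B = {fst x'}"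
    using on AB crossing_passages_inside[of A] crossing_passages_inside[of B]
    by (simp_all add: Field_insert_pair on_one_strand)
  have bars: "bars D \<inter> closed_strand A = {a1, a2}" "bars D' \<inter> closed_strand A = {}"
    "bars D \<inter> closed_strand B = {b1, b2}" "bars D' \<inter> closed_strand B = {}"
    using bars_inside[of A] bars_inside[of B] ab AB by (simp_all add: on_one_strand)
  have "a1 \<noteq> a2" "b1 \<noteq> b2" using btw unfolding strictly_between_def by auto
  then have match: "parity_matched F D D'"
    using crossings bars crossing_passages_outside bars_outside by (auto simp: parity_matched_def)
  have "contribution D x = contribution D' x'"
  proof (cases "fst A = fst B")
    case True
    note marks = marks_single[OF crossings(1)] marks_single[OF crossings(2)] marks_single[OF crossings(3)]
      marks_single[OF crossings(4)] marks_none[OF bars(2)] marks_none[OF bars(4)]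
      marks_straddling[OF bars(1) btw(1)] marks_straddling[OF bars(3) btw(2)]
    have "component_weight D (over_component x) = component_weight D' (under_component x')"
      "component_weight D (under_component x) = component_weight D' (over_component x')"
      unfolding over_component_def under_component_def
      using on AB True
        component_weight_between_strands[OF family twisted match, of A B "fst x" "snd x'" "snd x" "fst x'"]
        component_weight_between_strands[OF family twisted match, of B A "snd x" "fst x'" "fst x" "snd x'"]
      by (simp_all add: marks)
    then show ?thesis using sign on on_fst True by (simp add: contribution_def mult.assoc mult.commute)
  next
    case False
    then show ?thesis using on on_fst by (simp add: contribution_def)
  qed
  then show ?thesis using match by (intro Q_poly_eqI) simp_all
qed

section \<open>Isotopies\<close>

lemma add_int_of_add_1:
  fixes f :: "real \<Rightarrow> 'a::real_vector"
  assumes "\<And>r. f (r + 1) = f r + c"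
  shows "f (r + of_int n) = f r + of_int n *\<^sub>R c"
proof (induction n rule: int_induct[of _ 0])
  case base
  then show ?case by simp
next
  case (step1 n)
  then show ?case using assms[of "r + of_int n"] by (simp add: algebra_simps)
next
  case (step2 n)
  then show ?case using assms[of "r + of_int (n - 1)"] by (simp add: algebra_simps)
qed

text \<open>
  The cyclic order of points of the circle in terms of their lifts to the line: some lift of \<open>r\<close>
  lies between \<open>p\<close> and the first lift of \<open>q\<close> after \<open>p\<close>.  In this form it is evidently
  invariant under integer shifts and under monotone maps that commute with them, whereas the
  definition of arcs by parameters in \<open>[0, 1)\<close> distinguishes the parameter 0.  With \<open>\<le>\<close> in the
  last inequality, also the case \<open>p = q\<close> agrees with that definition.
\<close>

definition cyclically_between :: "real \<Rightarrow> real \<Rightarrow> real \<Rightarrow> bool" where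
  "cyclically_between p r q \<longleftrightarrow>
     (\<exists>m n :: int. p < r + of_int m \<and> r + of_int m < q + of_int n \<and> q + of_int n \<le> p + 1)"

lemma cyclically_between_shift_imp:
  assumes "cyclically_between p r q"
  shows "cyclically_between (p + of_int a) (r + of_int b) (q + of_int c)"
proof -
  obtain m n :: int where "p < r + of_int m" "r + of_int m < q + of_int n" "q + of_int n \<le> p + 1"
    using assms unfolding cyclically_between_def by blast
  then show ?thesis unfolding cyclically_between_def
    by (intro exI[of _ "m + a - b"] exI[of _ "n + a - c"]) simp
qed

lemma cyclically_between_frac:
  "cyclically_between (frac p) (frac r) (frac q) \<longleftrightarrow> cyclically_between p r q"
  using cyclically_between_shift_imp[of p r q "- \<lfloor>p\<rfloor>" "- \<lfloor>r\<rfloor>" "- \<lfloor>q\<rfloor>"]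
    cyclically_between_shift_imp[of "frac p" "frac r" "frac q" "\<lfloor>p\<rfloor>" "\<lfloor>r\<rfloor>" "\<lfloor>q\<rfloor>"]
  by (auto simp: frac_def)

lemma cyclically_between_unit_interval:
  assumes "0 \<le> p" "p < 1" "0 \<le> q" "q < 1" "0 \<le> r" "r < 1"
  shows "cyclically_between p r q \<longleftrightarrow> (if p < q then p < r \<and> r < q else p < r \<or> r < q)"
proof
  assume "cyclically_between p r q"
  then obtain m n :: int where mn: "p < r + of_int m" "r + of_int m < q + of_int n" "q + of_int n \<le> p + 1"
    unfolding cyclically_between_def by blast
  have "real_of_int n < 2" "real_of_int n > -1" "real_of_int m > -1" "real_of_int m < 2"
    using mn assms by linarith+
  then have "n = 0 \<or> n = 1" "m = 0 \<or> m = 1" by linarith+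
  then show "if p < q then p < r \<and> r < q else p < r \<or> r < q" using mn assms by auto
next
  assume *: "if p < q then p < r \<and> r < q else p < r \<or> r < q"
  have "\<exists>m\<in>{0, 1}. \<exists>n\<in>{0, 1 :: int}. p < r + of_int m \<and> r + of_int m < q + of_int n \<and> q + of_int n \<le> p + 1"
    using * assms by (auto split: if_splits)
  then show "cyclically_between p r q" unfolding cyclically_between_def by blast
qed

lemma circle_reparamD:
  assumes "circle_reparam \<phi>"
  shows "\<phi> (r + of_int n) = \<phi> r + of_int n" "strict_mono \<phi>"
    "(\<phi> has_vector_derivative vector_derivative \<phi> (at r)) (at r)" "vector_derivative \<phi> (at r) > 0"
proof -
  show "\<phi> (r + of_int n) = \<phi> r + of_int n"
    using add_int_of_add_1[of \<phi> 1] assms unfolding circle_reparam_def by simp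
  have d: "(\<phi> has_vector_derivative vector_derivative \<phi> (at r)) (at r)" for r
    using assms unfolding circle_reparam_def C1_differentiable_on_eq by (auto simp: vector_derivative_works)
  then show "(\<phi> has_vector_derivative vector_derivative \<phi> (at r)) (at r)" .
  show "vector_derivative \<phi> (at r) > 0" using assms unfolding circle_reparam_def by simp
  show "strict_mono \<phi>"
  proof (rule strict_monoI)
    fix a b :: real assume "a < b"
    then show "\<phi> a < \<phi> b"
    proof (rule DERIV_pos_imp_increasing)
      show "\<exists>y. DERIV \<phi> x :> y \<and> 0 < y" for x
        using d[of x] assms unfolding circle_reparam_def has_real_derivative_iff_has_vector_derivative by blast
    qed
  qed
qed

lemma cyclically_between_reparam:
  assumes "circle_reparam \<phi>"
  shows "cyclically_between (\<phi> p) (\<phi> r) (\<phi> q) \<longleftrightarrow> cyclically_between p r q"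
proof -
  note shift = circle_reparamD(1)[OF assms, symmetric] 
  have "\<phi> q + of_int n \<le> \<phi> p + 1 \<longleftrightarrow> q + of_int n \<le> p + 1" for n
    using shift[of q n] shift[of p 1] strict_mono_less_eq[OF circle_reparamD(2)[OF assms]] by simp
  then show ?thesis unfolding cyclically_between_def
    by (simp add: shift strict_mono_less[OF circle_reparamD(2)[OF assms]])
qed

lemma inj_on_frac_reparam:
  assumes "circle_reparam \<phi>"
  shows "inj_on (\<lambda>r. frac (\<phi> r)) {0..<1}"
proof (rule inj_onI)
  fix r u :: real assume ru: "r \<in> {0..<1}" "u \<in> {0..<1}" and eq: "frac (\<phi> r) = frac (\<phi> u)"
  define n where "n = \<lfloor>\<phi> r\<rfloor> - \<lfloor>\<phi> u\<rfloor>"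
  have "\<phi> r = \<phi> (u + of_int n)"
    using eq circle_reparamD(1)[OF assms, of u n] unfolding frac_def n_def by simp
  then have *: "r = u + of_int n" using strict_mono_eq[OF circle_reparamD(2)[OF assms]] by blast
  then have "real_of_int n < 1" "real_of_int n > -1" using ru by auto
  then have "n = 0" by linarith
  then show "r = u" using * by simp
qed

text \<open>
  Along the isotopy, the Jacobian determinant at a given point is a continuous function of time
  without zeros, and it is 1 at the beginning.
\<close>

lemma plane_isotopy_end:
  assumes "plane_isotopy H"
  obtains J :: "real^2 \<Rightarrow> real^2^2" where
    "\<And>x. (H 1 has_derivative (\<lambda>v. J x *v v)) (at x)" "\<And>x. det (J x) > 0"
proof -
  from assms obtain J :: "real \<Rightarrow> real^2 \<Rightarrow> real^2^2" where H0: "H 0 = id"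
    and cont: "continuous_on ({0..1} \<times> UNIV) (\<lambda>(u, x). J u x)"
    and J: "\<And>u x. u \<in> {0..1} \<Longrightarrow> (H u has_derivative (\<lambda>v. J u x *v v)) (at x)"
      "\<And>u x. u \<in> {0..1} \<Longrightarrow> invertible (J u x)"
    unfolding plane_isotopy_def by blast
  have "det (J 1 x) > 0" for x
  proof (rule ccontr)
    assume neg: "\<not> det (J 1 x) > 0"
    have "continuous_on {0..1} (\<lambda>u. (\<lambda>(u, x). J u x) (u, x))"
      by (rule continuous_on_compose2[OF cont]) (auto intro!: continuous_intros)
    then have Jc: "continuous_on {0..1} (\<lambda>u. J u x)" by simp
    have dc: "continuous_on {0..1} (\<lambda>u. det (J u x))"
      unfolding det_2 by (intro continuous_intros Jc)
    have "(H 0 has_derivative (\<lambda>v. v)) (at x)" unfolding H0 id_def by (rule has_derivative_ident)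
    moreover have "(H 0 has_derivative (\<lambda>v. J 0 x *v v)) (at x)" using J(1)[of 0 x] by simp
    ultimately have "(\<lambda>v. v) = (\<lambda>v. J 0 x *v v)" by (rule has_derivative_unique)
    then have "J 0 x = mat 1" by (metis matrix_eq matrix_vector_mul_lid)
    then have "\<exists>u\<ge>0. u \<le> 1 \<and> det (J u x) = 0"
      using neg by (intro IVT2' dc) auto
    then show False using J(2) invertible_det_nz by force
  qed
  then show thesis using that[of "J 1"] J(1)[of 1] by auto
qed

locale diagram_isotopy =
  fixes D D' :: diagram and H :: "real \<Rightarrow> real^2 \<Rightarrow> real^2" and \<pi> :: "nat \<Rightarrow> nat"
    and \<phi> :: "nat \<Rightarrow> real \<Rightarrow> real"
  assumes twisted: "twisted_diagram D" "twisted_diagram D'" and isotopy: "plane_isotopy H"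
    and \<pi>: "bij_betw \<pi> {..<comps D} {..<comps D'}"
    and reparam: "i < comps D \<Longrightarrow> circle_reparam (\<phi> i)"
    and loop: "i < comps D \<Longrightarrow> loop D' (\<pi> i) (\<phi> i r) = H 1 (loop D i r)"
begin

definition \<tau> :: "passage \<Rightarrow> passage" where
  "\<tau> = (\<lambda>(i, r). (\<pi> i, frac (\<phi> i r)))"

lemma fst_\<tau>: "fst (\<tau> p) = \<pi> (fst p)" and snd_\<tau>: "snd (\<tau> p) = frac (\<phi> (fst p) (snd p))"
  unfolding \<tau>_def by (auto split: prod.splits)

lemma \<pi>_eq_iff: "p \<in> passages D \<Longrightarrow> q \<in> passages D \<Longrightarrow> \<pi> (fst p) = \<pi> (fst q) \<longleftrightarrow> fst p = fst q"
  using \<pi> unfolding bij_betw_def inj_on_def passages_def by auto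

lemma inj_on_\<tau>: "inj_on \<tau> (passages D)"
proof (rule inj_onI)
  fix p q assume pq: "p \<in> passages D" "q \<in> passages D" and eq: "\<tau> p = \<tau> q"
  then have fst: "fst p = fst q" using \<pi>_eq_iff fst_\<tau> by metis
  moreover have "snd p = snd q"
    using inj_onD[OF inj_on_frac_reparam[OF reparam[of "fst p"]], of "snd p" "snd q"] pq
      arg_cong[OF eq, of snd] fst unfolding snd_\<tau> passages_def by auto
  ultimately show "p = q" by (rule prod_eqI)
qed

lemma \<tau>_mem_arc_between:
  assumes "p \<in> passages D" "q \<in> passages D" "m \<in> passages D" "fst p = fst q"
  shows "\<tau> m \<in> arc_between (\<tau> p) (\<tau> q) \<longleftrightarrow> m \<in> arc_between p q"
proof (cases "fst m = fst p")
  case False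
  then show ?thesis using \<pi>_eq_iff assms unfolding mem_arc_between fst_\<tau> by blast
next
  case True
  have arc: "r \<in> arc_between s t \<longleftrightarrow> fst r = fst s \<and> cyclically_between (snd s) (snd r) (snd t)"
    if "{snd r, snd s, snd t} \<subseteq> {0..<1}" for r s t
    using that cyclically_between_unit_interval[of "snd s" "snd t" "snd r"] unfolding mem_arc_between by auto
  have "circle_reparam (\<phi> (fst p))" using assms reparam unfolding passages_def by auto
  then have "cyclically_between (snd (\<tau> p)) (snd (\<tau> m)) (snd (\<tau> q)) \<longleftrightarrow>
      cyclically_between (snd p) (snd m) (snd q)"
    unfolding snd_\<tau> cyclically_between_frac True assms(4)[symmetric] by (rule cyclically_between_reparam)
  moreover have "{snd m, snd p, snd q} \<subseteq> {0..<1}" using assms unfolding passages_def by auto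
  moreover have "{snd (\<tau> m), snd (\<tau> p), snd (\<tau> q)} \<subseteq> {0..<1}"
    unfolding snd_\<tau> by (simp add: frac_lt_1)
  ultimately show ?thesis using arc[of m p q] arc[of "\<tau> m" "\<tau> p" "\<tau> q"] True by (simp add: fst_\<tau>)
qed

text \<open>
  Up to a positive factor, the tangent vectors are transported by the derivative of the isotopy.
  The factor is the speed of the reparametrization.
\<close>

lemma tangent_\<tau>:
  assumes p: "p \<in> passages D" and J: "\<And>x. (H 1 has_derivative (\<lambda>v. J x *v v)) (at x)"
  obtains k where "k > 0" "k *\<^sub>R tangent D' (\<tau> p) = J (pt D p) *v tangent D p"
proof
  define i r where "i = fst p" and "r = snd p"
  have i: "i < comps D" using p unfolding passages_def i_def by auto
  then have \<pi>i: "\<pi> i < comps D'" using \<pi> unfolding bij_betw_def by auto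
  let ?k = "vector_derivative (\<phi> i) (at r)"
  show "?k > 0" using circle_reparamD(4)[OF reparam[OF i]] .
  have per: "loop D' (\<pi> i) (t + of_int n) = loop D' (\<pi> i) t" for t n
    using add_int_of_add_1[of "loop D' (\<pi> i)" 0] twisted(2) \<pi>i unfolding twisted_diagram_def by simp
  \<comment> \<open>Shifting \<open>\<phi> i\<close> by an integer makes it hit the representative \<open>frac (\<phi> i r)\<close> of the passage at
    \<open>r\<close>, and does not change the loop.\<close>
  define g where "g t = \<phi> i t - of_int \<lfloor>\<phi> i r\<rfloor>" for t
  have gr: "g r = frac (\<phi> i r)" unfolding g_def frac_def ..
  have "(g has_vector_derivative ?k - 0) (at r)"
    unfolding g_def by (intro derivative_intros circle_reparamD(3)[OF reparam[OF i]])
  then have g: "(g has_vector_derivative ?k) (at r)" by simp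
  have eq: "loop D' (\<pi> i) \<circ> g = H 1 \<circ> loop D i"
  proof
    fix t
    show "(loop D' (\<pi> i) \<circ> g) t = (H 1 \<circ> loop D i) t"
      using per[of "\<phi> i t" "- \<lfloor>\<phi> i r\<rfloor>"] loop[OF i] unfolding g_def by simp
  qed
  have "(loop D' (\<pi> i) \<circ> g has_vector_derivative ?k *\<^sub>R vector_derivative (loop D' (\<pi> i)) (at (g r))) (at r)"
    by (rule vector_diff_chain_at[OF g loop_has_vector_derivative[OF twisted(2) \<pi>i]])
  moreover have "(H 1 \<circ> loop D i has_vector_derivative
      J (loop D i r) *v vector_derivative (loop D i) (at r)) (at r)"
    by (rule vector_derivative_diff_chain_within[OF loop_has_vector_derivative[OF twisted(1) i]
          has_derivative_at_withinI[OF J]])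
  ultimately show "?k *\<^sub>R tangent D' (\<tau> p) = J (pt D p) *v tangent D p"
    unfolding eq tangent_def pt_def fst_\<tau> snd_\<tau> i_def[symmetric] r_def[symmetric] gr
    by (rule vector_derivative_unique_at)
qed

lemma crossing_sign_\<tau>:
  assumes "p \<in> passages D" "q \<in> passages D" "pt D p = pt D q"
  shows "crossing_sign D' (\<tau> p, \<tau> q) = crossing_sign D (p, q)"
proof -
  obtain J :: "real^2 \<Rightarrow> real^2^2" where J: "\<And>x. (H 1 has_derivative (\<lambda>v. J x *v v)) (at x)"
    and det: "\<And>x. det (J x) > 0"
    using plane_isotopy_end[OF isotopy] by blast
  obtain k where k: "k > 0" "k *\<^sub>R tangent D' (\<tau> p) = J (pt D p) *v tangent D p"
    using tangent_\<tau>[OF assms(1) J] .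
  obtain l where l: "l > 0" "l *\<^sub>R tangent D' (\<tau> q) = J (pt D p) *v tangent D q"
    using tangent_\<tau>[OF assms(2) J] assms(3) by metis
  have mult: "det (vector [M *v a, M *v b] :: real^2^2) = det M * det (vector [a, b] :: real^2^2)"
    for M :: "real^2^2" and a b
    unfolding det_2 matrix_vector_mult_def by (simp add: sum_2 algebra_simps)
  have scale: "det (vector [k *\<^sub>R a, l *\<^sub>R b] :: real^2^2) = k * l * det (vector [a, b] :: real^2^2)"
    for a b :: "real^2"
    unfolding det_2 by (simp add: algebra_simps)
  have "k * l * tangent_det D' (\<tau> p, \<tau> q) = det (J (pt D p)) * tangent_det D (p, q)"
    using mult scale k(2) l(2) unfolding tangent_det_def by (metis fst_conv snd_conv)
  moreover have "0 < k * l * tangent_det D' (\<tau> p, \<tau> q) \<longleftrightarrow> 0 < tangent_det D' (\<tau> p, \<tau> q)"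
    using mult_less_cancel_left_pos[OF mult_pos_pos[OF k(1) l(1)], of 0] by simp
  moreover have "0 < det (J (pt D p)) * tangent_det D (p, q) \<longleftrightarrow> 0 < tangent_det D (p, q)"
    using det[of "pt D p"] by (simp add: zero_less_mult_iff)
  ultimately show ?thesis unfolding crossing_sign_def by simp
qed

lemma component_weight_\<tau>:
  assumes "p \<in> passages D" "q \<in> passages D" "fst p = fst q"
    and "crossing_passages D' = \<tau> ` crossing_passages D" "bars D' = \<tau> ` bars D"
  shows "component_weight D' (arc_between (\<tau> p) (\<tau> q)) = component_weight D (arc_between p q)"
proof -
  have card: "card (\<tau> ` M \<inter> arc_between (\<tau> p) (\<tau> q)) = card (M \<inter> arc_between p q)"
    if M: "M \<subseteq> passages D" for M
  proof -
    have "\<tau> ` M \<inter> arc_between (\<tau> p) (\<tau> q) = \<tau> ` (M \<inter> arc_between p q)"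
      using \<tau>_mem_arc_between[OF assms(1,2) _ assms(3)] M by blast
    moreover have "inj_on \<tau> (M \<inter> arc_between p q)"
      using inj_on_subset[OF inj_on_\<tau>] M by blast
    ultimately show ?thesis by (simp add: card_image)
  qed
  show ?thesis
    using card[OF crossing_passages_subset[OF twisted(1)]] card[OF twisted_diagramD(3)[OF twisted(1)]]
    by (intro component_weight_cong twisted) (simp_all add: assms(4,5))
qed

lemma Q_poly_\<tau>:
  assumes classical: "classical D' = map_prod \<tau> \<tau> ` classical D" and bars: "bars D' = \<tau> ` bars D"
  shows "Q_poly D = Q_poly D'"
proof -
  have passages: "crossing_passages D' = \<tau> ` crossing_passages D"
    unfolding crossing_passages_def classical Field_def by force
  have sub: "classical D \<subseteq> passages D \<times> passages D" using classicalD[OF twisted(1)] by fastforce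
  have "inj_on (map_prod \<tau> \<tau>) (classical D)"
    by (rule inj_on_subset[OF map_prod_inj_on[OF inj_on_\<tau> inj_on_\<tau>] sub])
  then have "Q_poly D' = (\<Sum>c\<in>classical D. contribution D' (map_prod \<tau> \<tau> c))"
    unfolding Q_poly_eq_sum_contribution[OF twisted(2)] classical by (simp add: sum.reindex)
  also have "\<dots> = (\<Sum>c\<in>classical D. contribution D c)"
  proof (rule sum.cong[OF refl])
    fix c assume "c \<in> classical D"
    note c = classicalD[OF twisted(1) this]
    show "contribution D' (map_prod \<tau> \<tau> c) = contribution D c"
    proof (rule contribution_eqI)
      show "fst (fst (map_prod \<tau> \<tau> c)) = fst (snd (map_prod \<tau> \<tau> c)) \<longleftrightarrow> fst (fst c) = fst (snd c)"
        using \<pi>_eq_iff[OF c(1,2)] by (simp add: fst_\<tau>)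
      then have self: "fst (fst (map_prod \<tau> \<tau> c)) = fst (snd (map_prod \<tau> \<tau> c)) \<Longrightarrow>
          fst (fst c) = fst (snd c)" by simp
      show "crossing_sign D c = crossing_sign D' (map_prod \<tau> \<tau> c)"
        using crossing_sign_\<tau>[OF c(1,2,4)] by (cases c) simp
      show "component_weight D' (over_component (map_prod \<tau> \<tau> c)) = component_weight D (over_component c) \<and>
          component_weight D' (under_component (map_prod \<tau> \<tau> c)) = component_weight D (under_component c)"
        if "fst (fst (map_prod \<tau> \<tau> c)) = fst (snd (map_prod \<tau> \<tau> c))"
        unfolding over_component_def under_component_def
        using component_weight_\<tau>[OF c(1,2) self[OF that] passages bars]
          component_weight_\<tau>[OF c(2,1) self[OF that, symmetric] passages bars] by simp
    qed
  qed
  finally show ?thesis using Q_poly_eq_sum_contribution[OF twisted(1)] by simp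
qed

end

lemma isotopic_Q_poly:
  assumes "isotopic D D'"
  shows "Q_poly D = Q_poly D'"
proof -
  obtain H \<pi> \<phi> where iso: "twisted_diagram D" "twisted_diagram D'" "plane_isotopy H"
      "bij_betw \<pi> {..<comps D} {..<comps D'}"
      "\<And>i. i < comps D \<Longrightarrow> circle_reparam (\<phi> i)"
      "\<And>i r. i < comps D \<Longrightarrow> loop D' (\<pi> i) (\<phi> i r) = H 1 (loop D i r)"
    and images: "classical D' = map_prod (\<lambda>(i, r). (\<pi> i, frac (\<phi> i r))) (\<lambda>(i, r). (\<pi> i, frac (\<phi> i r))) ` classical D"
      "bars D' = (\<lambda>(i, r). (\<pi> i, frac (\<phi> i r))) ` bars D"
    using assms unfolding isotopic_def Let_def by (elim exE conjE) (rule that; simp)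
  interpret diagram_isotopy D D' H \<pi> \<phi> using iso by unfold_locales
  show ?thesis using images unfolding \<tau>_def[symmetric] by (rule Q_poly_\<tau>)
qed

lemma twisted_link_step_Q_poly:
  assumes "twisted_link_step D D'"
  shows "Q_poly D = Q_poly D'"
  using assms isotopic_Q_poly reidemeister_1_Q_poly reidemeister_2_Q_poly reidemeister_3_Q_poly
    virtual_moves_Q_poly virtual_4_Q_poly twisted_1_Q_poly twisted_2_Q_poly twisted_3_Q_poly
  unfolding twisted_link_step_def by metis

theorem theorem29:
  fixes D D' :: diagram
  assumes "twisted_diagram D" and "twisted_diagram D'"
    and "equivalent_diagrams D D'"
  shows "Q_poly D = Q_poly D'"
  using assms(3) unfolding equivalent_diagrams_def
proof (induction rule: equivclp_induct)
  case base
  show ?case ..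
next
  case (step y z)
  then show ?case using twisted_link_step_Q_poly by metis
qed

end
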